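(* Let $\Bbbk$ be a field of characteristic zero and let $V=V_0\oplus V_1$ be a finite-dimensional special GD-superalgebra over $\Bbbk$. Then the quadratic Lie conformal superalgebra $L(V)$ has a finite faithful conformal representation.
   Context: All spaces are over $\Bbbk$; $H=\Bbbk[\partial]$ is the polynomial algebra in one variable; $|a|\in\{0,1\}$ is the parity of a homogeneous element $a$; all operations respect the $\mathbb Z_2$-grading. A Novikov superalgebra is a $\mathbb Z_2$-graded space $V=V_0\oplus V_1$ with a bilinear grading-respecting product $\circ$ such that for all homogeneous $a,b,c$: $(a\circ b)\circ c-a\circ(b\circ c)=(-1)^{|a||b|}\big((b\circ a)\circ c-b\circ(a\circ c)\big)$ and $(a\circ b)\circ c=(-1)^{|b||c|}(a\circ c)\circ b$. A GD-superalgebra (Gelfand--Dorfman superalgebra) is a $\mathbb Z_2$-graded space $V$ with bilinear grading-respecting operations $(\cdot\circ\cdot)$, $[\cdot,\cdot]$ such that $(V,\circ)$ is a Novikov superalgebra, $(V,[\cdot,\cdot])$ is a Lie superalgebra, and for all homogeneous $a,b,c\in V$ $$[a\circ b,c]-a\circ[b,c]+[a,b]\circ c+(-1)^{|a||b|}[b,a\circ c]-(-1)^{|b||c|}[a,c]\circ b=0.$$ A Poisson superalgebra is an associative supercommutative superalgebra $P=P_0\oplus P_1$ with a bilinear grading-respecting bracket $\{\cdot,\cdot\}$ such that for homogeneous $a,b,c$: $\{a,b\}=-(-1)^{|a||b|}\{b,a\}$, $\{a,\{b,c\}\}-(-1)^{|a||b|}\{b,\{a,c\}\}=\{\{a,b\},c\}$,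 $\{a,bc\}=\{a,b\}c+(-1)^{|a||b|}b\{a,c\}$. An even derivation of $P$ is a linear map $d:P\to P$ with $d(P_i)\subseteq P_i$, $d(ab)=d(a)b+ad(b)$, $d\{a,b\}=\{d(a),b\}+\{a,d(b)\}$. Given such $d$, $P^{(d)}$ denotes the GD-superalgebra on the space $P$ with operations $a\circ b=ad(b)$, $[a,b]=\{a,b\}$. A GD-superalgebra $V$ is special if there exist a Poisson superalgebra $P$ and an even derivation $d$ of $P$ such that $V\subseteq P^{(d)}$, i.e. there is an injective even linear map $V\to P$ that preserves both operations. A Lie conformal superalgebra is a $\mathbb Z_2$-graded $H$-module $C=C_0\oplus C_1$ with a linear map $[\cdot\,{}_{(\lambda)}\,\cdot]:C\otimes C\to C[\lambda]$ such that $[C_i\,{}_{(\lambda)}\,C_j]\subseteq C_{(i+j)\bmod 2}[\lambda]$ and, for homogeneous $x,y,z\in C$: (sesqui-linearity) $[\partial x\,{}_{(\lambda)}\,y]=-\lambda[x\,{}_{(\lambda)}\,y]$, $[x\,{}_{(\lambda)}\,\partial y]=(\partial+\lambda)[x\,{}_{(\lambda)}\,y]$; $[x\,{}_{(\lambda)}\,y]=-(-1)^{|x||y|}[y\,{}_{(-\partial-\lambda)}\,x]$; $[x\,{}_{(\lambda)}\,[y\,{}_{(\mu)}\,z]]-(-1)^{|x||y|}[y\,{}_{(\mu)}\,[x\,{}_{(\lambda)}\,z]]=[[x\,{}_{(\lambda)}\,y]\,{}_{(\lambda+\mu)}\,z]$. Here if $[y\,{}_{(\lambda)}\,x]=\sum_n\lambda^nc_n$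 then $[y\,{}_{(-\partial-\lambda)}\,x]=\sum_n(-\partial-\lambda)^nc_n$. For a GD-superalgebra $V$, the quadratic Lie conformal superalgebra $L(V)$ is the free $H$-module $H\otimes V$ with the $\lambda$-bracket determined by sesqui-linearity and $$[a\,{}_{(\lambda)}\,b]=[a,b]+(-1)^{|a||b|}(\partial+\lambda)(b\circ a)+\lambda(a\circ b)$$ for homogeneous $a,b\in V$. A representation of a Lie conformal superalgebra $L$ on a $\mathbb Z_2$-graded $H$-module $M=M_0\oplus M_1$ is a linear map $\rho_\lambda(\cdot,\cdot):L\otimes M\to M[\lambda]$ which respects the gradings, is sesqui-linear ($\rho_\lambda(\partial a,x)=-\lambda\rho_\lambda(a,x)$, $\rho_\lambda(a,\partial x)=(\partial+\lambda)\rho_\lambda(a,x)$), and satisfies $\rho_\lambda(a,\rho_\mu(b,x))-(-1)^{|a||b|}\rho_\mu(b,\rho_\lambda(a,x))=\rho_{\lambda+\mu}([a\,{}_{(\lambda)}\,b],x)$ for homogeneous $a,b\in L$ and $x\in M$. A finite representation is a representation on a free $H$-module $M=H\otimes U$, $M_i=H\otimes U_i$, with $U=U_0\oplus U_1$ a finite-dimensional $\mathbb Z_2$-graded space (equivalently, a homomorphism $L\to\mathrm{gc}_{n|m}$ with $n=\dim U_0$, $m=\dim U_1$). It is faithful if $\rho_\lambda(a,\cdot)=0$ implies $a=0$ for $a\in L$. *)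

theory Defs
  imports
    "HOL-Library.Z2"
    "HOL-Library.Function_Algebras"
    "HOL-Computational_Algebra.Polynomial"
begin

section \<open>Superspaces\<close>

text \<open>
  A \<open>\<int>\<^sub>2\<close>-grading is a family \<open>G :: bit \<Rightarrow> 'm set\<close> of homogeneous components, \<open>bit\<close> being the
  field with two elements.  The graded module is the subset \<open>super_carrier G\<close> of the ambient type,
  which need not be the whole type.  Over a field, \<^locale>\<open>module\<close> means the same as
  \<^locale>\<open>vector_space\<close>.
\<close>

definition super_carrier :: "(bit \<Rightarrow> 'm::plus set) \<Rightarrow> 'm set" where
  "super_carrier G = {x + y | x y. x \<in> G 0 \<and> y \<in> G 1}"

locale super_module = module scale
  for scale :: "'r::comm_ring_1 \<Rightarrow> 'm::ab_group_add \<Rightarrow> 'm" +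
  fixes G :: "bit \<Rightarrow> 'm set"
  assumes subspace_G: "subspace (G i)"
    and G_independent: "G 0 \<inter> G 1 = {0}"

locale full_super_module = super_module +
  assumes G_spans: "super_carrier G = UNIV"

text \<open>\<open>ksgn i j x\<close> is \<open>(-1)\<^bsup>ij\<^esup> x\<close>.\<close>

definition ksgn :: "bit \<Rightarrow> bit \<Rightarrow> 'm::uminus \<Rightarrow> 'm" where
  "ksgn i j x = (if i = 1 \<and> j = 1 then - x else x)"

definition hcomp :: "(bit \<Rightarrow> 'm::ab_group_add set) \<Rightarrow> bit \<Rightarrow> 'm \<Rightarrow> 'm" where
  "hcomp G i x = (THE y. y \<in> G i \<and> x - y \<in> G (i + 1))"

definition finite_dim :: "('k::field \<Rightarrow> 'v::ab_group_add \<Rightarrow> 'v) \<Rightarrow> 'v set \<Rightarrow> bool" where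
  "finite_dim s S \<longleftrightarrow> (\<exists>B. finite B \<and> module.span s B = S)"

section \<open>Novikov, Lie, Gelfand--Dorfman and Poisson superalgebras\<close>

locale superalgebra = full_super_module s V
  for s :: "'k::field \<Rightarrow> 'v::ab_group_add \<Rightarrow> 'v" and V +
  fixes mul :: "'v \<Rightarrow> 'v \<Rightarrow> 'v"
  assumes linear_left: "module_hom s s (\<lambda>a. mul a b)"
    and linear_right: "module_hom s s (\<lambda>b. mul a b)"
    and graded: "a \<in> V i \<Longrightarrow> b \<in> V j \<Longrightarrow> mul a b \<in> V (i + j)"

locale novikov_superalgebra = superalgebra s V circ
  for s :: "'k::field \<Rightarrow> 'v::ab_group_add \<Rightarrow> 'v" and V and circ (infixl "\<circ>\<^sub>N" 70) +
  assumes left_symmetric: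
      "a \<in> V i \<Longrightarrow> b \<in> V j \<Longrightarrow> c \<in> V k \<Longrightarrow>
        (a \<circ>\<^sub>N b) \<circ>\<^sub>N c - a \<circ>\<^sub>N (b \<circ>\<^sub>N c) = ksgn i j ((b \<circ>\<^sub>N a) \<circ>\<^sub>N c - b \<circ>\<^sub>N (a \<circ>\<^sub>N c))"
    and right_commutative:
      "a \<in> V i \<Longrightarrow> b \<in> V j \<Longrightarrow> c \<in> V k \<Longrightarrow>
        (a \<circ>\<^sub>N b) \<circ>\<^sub>N c = ksgn j k ((a \<circ>\<^sub>N c) \<circ>\<^sub>N b)"

locale lie_superalgebra = superalgebra s V brk
  for s :: "'k::field \<Rightarrow> 'v::ab_group_add \<Rightarrow> 'v" and V and brk +
  assumes super_skew:
      "a \<in> V i \<Longrightarrow> b \<in> V j \<Longrightarrow> brk a b = - ksgn i j (brk b a)"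
    and super_jacobi:
      "a \<in> V i \<Longrightarrow> b \<in> V j \<Longrightarrow> c \<in> V k \<Longrightarrow>
        brk a (brk b c) - ksgn i j (brk b (brk a c)) = brk (brk a b) c"

locale gd_superalgebra =
  novikov_superalgebra s V circ + lie_superalgebra s V brk
  for s :: "'k::field \<Rightarrow> 'v::ab_group_add \<Rightarrow> 'v" and V and circ (infixl "\<circ>\<^sub>N" 70) and brk +
  assumes gd_compatible:
      "a \<in> V i \<Longrightarrow> b \<in> V j \<Longrightarrow> c \<in> V k \<Longrightarrow>
        brk (a \<circ>\<^sub>N b) c - a \<circ>\<^sub>N brk b c + brk a b \<circ>\<^sub>N c
          + ksgn i j (brk b (a \<circ>\<^sub>N c)) - ksgn j k (brk a c \<circ>\<^sub>N b) = 0"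

text \<open>Associative and supercommutative; no unit is required.\<close>

locale poisson_superalgebra =
  superalgebra s P mul + lie_superalgebra s P pb
  for s :: "'k::field \<Rightarrow> 'p::ab_group_add \<Rightarrow> 'p" and P and mul (infixl "\<cdot>" 70) and pb +
  assumes mul_assoc: "(a \<cdot> b) \<cdot> c = a \<cdot> (b \<cdot> c)"
    and super_commutative:
      "a \<in> P i \<Longrightarrow> b \<in> P j \<Longrightarrow> a \<cdot> b = ksgn i j (b \<cdot> a)"
    and leibniz:
      "a \<in> P i \<Longrightarrow> b \<in> P j \<Longrightarrow> c \<in> P k \<Longrightarrow>
        pb a (b \<cdot> c) = pb a b \<cdot> c + ksgn i j (b \<cdot> pb a c)"

locale poisson_superalgebra_derivation =
  poisson_superalgebra s P mul pb
  for s :: "'k::field \<Rightarrow> 'p::ab_group_add \<Rightarrow> 'p" and P and mul (infixl "\<cdot>" 70) and pb +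
  fixes d :: "'p \<Rightarrow> 'p"
  assumes d_linear: "module_hom s s d"
    and d_even: "d ` P i \<subseteq> P i"
    and d_mul: "d (a \<cdot> b) = d a \<cdot> b + a \<cdot> d b"
    and d_pb: "d (pb a b) = pb (d a) b + pb a (d b)"

definition deriv_circ :: "('p \<Rightarrow> 'p \<Rightarrow> 'p) \<Rightarrow> ('p \<Rightarrow> 'p) \<Rightarrow> 'p \<Rightarrow> 'p \<Rightarrow> 'p" where
  "deriv_circ mul d a b = mul a (d b)"

text \<open>
  The type of the Poisson superalgebra cannot be quantified inside a formula, so it is a parameter
  of the predicate.  Used as a hypothesis with a free type variable \<open>'p\<close>, it covers every type.
\<close>

definition special_gd_superalgebra ::
    "'p::ab_group_add itself \<Rightarrow> ('k::field \<Rightarrow> 'v::ab_group_add \<Rightarrow> 'v) \<Rightarrow> (bit \<Rightarrow> 'v set)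
      \<Rightarrow> ('v \<Rightarrow> 'v \<Rightarrow> 'v) \<Rightarrow> ('v \<Rightarrow> 'v \<Rightarrow> 'v) \<Rightarrow> bool" where
  "special_gd_superalgebra TYPE('p) s V circ brk \<longleftrightarrow>
    gd_superalgebra s V circ brk \<and>
    (\<exists>(sP :: 'k \<Rightarrow> 'p \<Rightarrow> 'p) P mul pb d \<phi>.
      poisson_superalgebra_derivation sP P mul pb d \<and>
      module_hom s sP \<phi> \<and> inj \<phi> \<and> (\<forall>i. \<phi> ` V i \<subseteq> P i) \<and>
      (\<forall>a b. \<phi> (circ a b) = deriv_circ mul d (\<phi> a) (\<phi> b)) \<and>
      (\<forall>a b. \<phi> (brk a b) = pb (\<phi> a) (\<phi> b)))"

section \<open>Lie conformal superalgebras and their representations\<close>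

text \<open>
  \<open>H = 'k poly\<close>.  For an \<open>H\<close>-module with scaling \<open>h\<close>, \<open>kscale h\<close> is the scaling by constants and
  \<open>del h\<close> the action of \<open>\<partial>\<close>.
\<close>

definition kscale :: "('k::comm_ring_1 poly \<Rightarrow> 'c \<Rightarrow> 'c) \<Rightarrow> 'k \<Rightarrow> 'c \<Rightarrow> 'c" where
  "kscale h t x = h [:t:] x"

definition del :: "('k::comm_ring_1 poly \<Rightarrow> 'c \<Rightarrow> 'c) \<Rightarrow> 'c \<Rightarrow> 'c" where
  "del h x = h [:0, 1:] x"

text \<open>
  \<open>C[\<lambda>]\<close> is \<open>'c poly\<close>: multiplication by \<open>\<lambda>\<close> is \<open>pCons 0\<close>, and linear maps of \<open>C\<close> act through
  \<open>map_poly\<close>.  \<open>C[\<lambda>,\<mu>]\<close> is \<open>'c poly poly\<close> with outer variable \<open>\<lambda>\<close> and inner variable \<open>\<mu>\<close>.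
  \<open>subst_poly T \<iota> f\<close> is the result of substituting the operator \<open>T\<close> for the variable of \<open>f\<close>:
  it maps \<open>\<Sum>\<^sub>n c\<^sub>n \<lambda>\<^sup>n\<close> to \<open>\<Sum>\<^sub>n T\<^sup>n (\<iota> c\<^sub>n)\<close>.
\<close>

definition subst_poly :: "('b::comm_monoid_add \<Rightarrow> 'b) \<Rightarrow> ('a::zero \<Rightarrow> 'b) \<Rightarrow> 'a poly \<Rightarrow> 'b" where
  "subst_poly T \<iota> f = (\<Sum>n\<le>degree f. (T ^^ n) (\<iota> (coeff f n)))"

definition mul_lam :: "'c::zero poly poly \<Rightarrow> 'c poly poly" where
  "mul_lam g = pCons 0 g"

definition mul_mu :: "'c::zero poly poly \<Rightarrow> 'c poly poly" where
  "mul_mu g = map_poly (pCons 0) g"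

definition emb2 :: "'c::zero \<Rightarrow> 'c poly poly" where
  "emb2 c = [:[:c:]:]"

text \<open>
  \<open>nested T f T' g x\<close> is \<open>f\<close> with parameter \<open>T\<close> applied to \<open>g\<close> with parameter \<open>T'\<close> applied to \<open>x\<close>;
  thus \<open>nested mul_lam (br x) mul_mu (br y) z\<close> is \<open>[x \<^sub>\<lambda> [y \<^sub>\<mu> z]]\<close>.
\<close>

definition nested ::
    "('m::ab_group_add poly poly \<Rightarrow> 'm poly poly) \<Rightarrow> ('m \<Rightarrow> 'm poly)
      \<Rightarrow> ('m poly poly \<Rightarrow> 'm poly poly) \<Rightarrow> ('m \<Rightarrow> 'm poly) \<Rightarrow> 'm \<Rightarrow> 'm poly poly" where
  "nested T f T' g x = subst_poly T' (\<lambda>y. subst_poly T emb2 (f y)) (g x)"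

text \<open>\<open>lam_plus_mu F u = F\<^bsub>\<lambda>+\<mu>\<^esub>(u)\<close> for \<open>u = \<Sum>\<^sub>n c\<^sub>n \<lambda>\<^sup>n\<close>, i.e. \<open>\<Sum>\<^sub>n \<lambda>\<^sup>n F\<^bsub>\<lambda>+\<mu>\<^esub>(c\<^sub>n)\<close>.\<close>

definition lam_plus_mu ::
    "('c::zero \<Rightarrow> 'm::ab_group_add poly) \<Rightarrow> 'c poly \<Rightarrow> 'm poly poly" where
  "lam_plus_mu F u =
    subst_poly mul_lam (\<lambda>c. subst_poly (\<lambda>g. mul_lam g + mul_mu g) emb2 (F c)) u"

locale lie_conformal_superalgebra = full_super_module h C
  for h :: "'k::field poly \<Rightarrow> 'c::ab_group_add \<Rightarrow> 'c" and C +
  fixes br :: "'c \<Rightarrow> 'c \<Rightarrow> 'c poly"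
  assumes br_linear_left:
      "module_hom (kscale h) (\<lambda>t. map_poly (kscale h t)) (\<lambda>x. br x y)"
    and br_linear_right:
      "module_hom (kscale h) (\<lambda>t. map_poly (kscale h t)) (\<lambda>y. br x y)"
    and br_graded: "x \<in> C i \<Longrightarrow> y \<in> C j \<Longrightarrow> coeff (br x y) n \<in> C (i + j)"
    and br_del_left: "br (del h x) y = - pCons 0 (br x y)"
    and br_del_right: "br x (del h y) = map_poly (del h) (br x y) + pCons 0 (br x y)"
    and br_skew: "x \<in> C i \<Longrightarrow> y \<in> C j \<Longrightarrow>
      br x y = - ksgn i j
        (subst_poly (\<lambda>g. - map_poly (del h) g - pCons 0 g) (\<lambda>c. [:c:]) (br y x))"
    and br_jacobi: "x \<in> C i \<Longrightarrow> y \<in> C j \<Longrightarrow> z \<in> C k \<Longrightarrow>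
      nested mul_lam (br x) mul_mu (br y) z - ksgn i j (nested mul_mu (br y) mul_lam (br x) z)
        = lam_plus_mu (\<lambda>c. br c z) (br x y)"

locale conformal_representation =
  L: lie_conformal_superalgebra h C br + M: super_module hM M
  for h :: "'k::field poly \<Rightarrow> 'c::ab_group_add \<Rightarrow> 'c" and C br
    and hM :: "'k poly \<Rightarrow> 'm::ab_group_add \<Rightarrow> 'm" and M +
  fixes \<rho> :: "'c \<Rightarrow> 'm \<Rightarrow> 'm poly"
  assumes rep_add_left: "x \<in> super_carrier M \<Longrightarrow> \<rho> (a + b) x = \<rho> a x + \<rho> b x"
    and rep_scale_left: "x \<in> super_carrier M \<Longrightarrow>
      \<rho> (kscale h t a) x = map_poly (kscale hM t) (\<rho> a x)"
    and rep_add_right: "x \<in> super_carrier M \<Longrightarrow> y \<in> super_carrier M \<Longrightarrow>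
      \<rho> a (x + y) = \<rho> a x + \<rho> a y"
    and rep_scale_right: "x \<in> super_carrier M \<Longrightarrow>
      \<rho> a (kscale hM t x) = map_poly (kscale hM t) (\<rho> a x)"
    and rep_graded: "a \<in> C i \<Longrightarrow> x \<in> M j \<Longrightarrow> coeff (\<rho> a x) n \<in> M (i + j)"
    and rep_del_left: "x \<in> super_carrier M \<Longrightarrow> \<rho> (del h a) x = - pCons 0 (\<rho> a x)"
    and rep_del_right: "x \<in> super_carrier M \<Longrightarrow>
      \<rho> a (del hM x) = map_poly (del hM) (\<rho> a x) + pCons 0 (\<rho> a x)"
    and rep_bracket: "a \<in> C i \<Longrightarrow> b \<in> C j \<Longrightarrow> x \<in> M k \<Longrightarrow>
      nested mul_lam (\<rho> a) mul_mu (\<rho> b) x - ksgn i j (nested mul_mu (\<rho> b) mul_lam (\<rho> a) x)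
        = lam_plus_mu (\<lambda>c. \<rho> c x) (br a b)"

definition faithful_rep ::
    "(bit \<Rightarrow> 'm::ab_group_add set) \<Rightarrow> ('c::zero \<Rightarrow> 'm \<Rightarrow> 'm poly) \<Rightarrow> bool" where
  "faithful_rep M \<rho> \<longleftrightarrow> (\<forall>a. (\<forall>x\<in>super_carrier M. \<rho> a x = 0) \<longrightarrow> a = 0)"

section \<open>Free \<open>H\<close>-modules and quadratic Lie conformal superalgebras\<close>

text \<open>
  \<open>H \<otimes> V\<close> is \<open>'v poly\<close>, with \<open>\<Sum>\<^sub>n \<partial>\<^sup>n \<otimes> v\<^sub>n\<close> having the coefficients \<open>v\<^sub>n\<close>.
\<close>

definition hscale :: "('k::comm_ring_1 \<Rightarrow> 'v::ab_group_add \<Rightarrow> 'v) \<Rightarrow> 'k poly \<Rightarrow> 'v poly \<Rightarrow> 'v poly" where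
  "hscale s p f = fold_coeffs (\<lambda>t g. map_poly (s t) f + pCons 0 g) p 0"

lemma del_hscale:
  assumes "module s"
  shows "del (hscale s) f = pCons 0 f"
proof -
  interpret module s by fact
  have 1: "map_poly (s 1) f = f" and 0: "map_poly (s 0) f = 0"
    by (auto intro!: poly_eqI simp: coeff_map_poly)
  show ?thesis
    by (simp add: del_def hscale_def 0 1)
qed

lemma kscale_hscale:
  assumes "module s"
  shows "kscale (hscale s) t f = map_poly (s t) f"
proof -
  interpret module s by fact
  have 0: "map_poly (s 0) f = 0"
    by (auto intro!: poly_eqI simp: coeff_map_poly)
  show ?thesis
    by (cases "t = 0") (auto simp: kscale_def hscale_def 0)
qed

definition hgrade :: "(bit \<Rightarrow> 'v::zero set) \<Rightarrow> bit \<Rightarrow> 'v poly set" where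
  "hgrade V i = {f. \<forall>n. coeff f n \<in> V i}"

text \<open>\<open>sopp V circ a b\<close> is the bilinear extension of \<open>(-1)\<^bsup>|a||b|\<^esup> b \<circ> a\<close>.\<close>

definition sopp :: "(bit \<Rightarrow> 'v::ab_group_add set) \<Rightarrow> ('v \<Rightarrow> 'v \<Rightarrow> 'v) \<Rightarrow> 'v \<Rightarrow> 'v \<Rightarrow> 'v" where
  "sopp V circ a b = (\<Sum>i\<in>{0, 1}. \<Sum>j\<in>{0, 1}. ksgn i j (circ (hcomp V j b) (hcomp V i a)))"

lemma (in super_module) hcomp_homogeneous:
  assumes "a \<in> G i"
  shows "hcomp G j a = (if j = i then a else 0)"
proof -
  have z: "0 \<in> G k" for k
    using subspace_G subspace_0 by blast
  have ind: "x = 0" if "x \<in> G k" "x \<in> G (k + 1)" for x k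
    using that G_independent by (cases k) auto
  show ?thesis
  proof (cases "j = i")
    case True
    have "y = a" if "y \<in> G i" "a - y \<in> G (i + 1)" for y
      using ind[of "a - y" i] that assms subspace_diff[OF subspace_G assms] by auto
    then have "(THE y. y \<in> G i \<and> a - y \<in> G (i + 1)) = a"
      by (intro the_equality) (use assms z in auto)
    with True show ?thesis
      by (simp add: hcomp_def)
  next
    case False
    then have i: "i = j + 1"
      by (cases i; cases j) auto
    have "y = 0" if "y \<in> G j" "a - y \<in> G (j + 1)" for y
      using ind[of y j] that assms i subspace_diff[OF subspace_G, of a i "a - y"] by auto
    then have "(THE y. y \<in> G j \<and> a - y \<in> G (j + 1)) = 0"
      by (intro the_equality) (use assms i z in auto)
    with False show ?thesis
      by (simp add: hcomp_def)
  qed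
qed

lemma (in superalgebra) sopp_homogeneous:
  assumes "a \<in> V i" "b \<in> V j"
  shows "sopp V mul a b = ksgn i j (mul b a)"
proof -
  have "mul 0 x = 0" "mul x 0 = 0" for x
    using module_hom.zero[OF linear_left] module_hom.zero[OF linear_right] by auto
  then show ?thesis
    using assms unfolding sopp_def
    by (cases i; cases j) (auto simp: hcomp_homogeneous ksgn_def)
qed

text \<open>
  In \<open>'v poly poly\<close> the outer variable is \<open>\<lambda>\<close> and the inner one is \<open>\<partial>\<close>, so the three summands are
  \<open>[a,b]\<close>, \<open>(\<partial> + \<lambda>) (\<plusminus> b \<circ> a)\<close> and \<open>\<lambda> (a \<circ> b)\<close>.
\<close>

definition quad_gen ::
    "(bit \<Rightarrow> 'v::ab_group_add set) \<Rightarrow> ('v \<Rightarrow> 'v \<Rightarrow> 'v) \<Rightarrow> ('v \<Rightarrow> 'v \<Rightarrow> 'v)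
      \<Rightarrow> 'v \<Rightarrow> 'v \<Rightarrow> 'v poly poly" where
  "quad_gen V circ brk a b =
    [:[:brk a b:]:]
    + ([:[:0, sopp V circ a b:]:] + [:0, [:sopp V circ a b:]:])
    + [:0, [:circ a b:]:]"

text \<open>Sesqui-linear extension: \<open>\<partial>\<close> acts as \<open>-\<lambda>\<close> on the left and as \<open>\<partial> + \<lambda>\<close> on the right.\<close>

definition quad_bracket ::
    "(bit \<Rightarrow> 'v::ab_group_add set) \<Rightarrow> ('v \<Rightarrow> 'v \<Rightarrow> 'v) \<Rightarrow> ('v \<Rightarrow> 'v \<Rightarrow> 'v)
      \<Rightarrow> 'v poly \<Rightarrow> 'v poly \<Rightarrow> 'v poly poly" where
  "quad_bracket V circ brk f g =
    subst_poly (\<lambda>u. - pCons 0 u)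
      (\<lambda>a. subst_poly (\<lambda>u. map_poly (pCons 0) u + pCons 0 u) (quad_gen V circ brk a) g) f"

lemma (in superalgebra) quad_bracket_generators:
  assumes "a \<in> V i" "b \<in> V j"
  shows "quad_bracket V mul brk [:a:] [:b:] =
    [:[:brk a b, ksgn i j (mul b a):], [:ksgn i j (mul b a) + mul a b:]:]"
  by (simp add: quad_bracket_def subst_poly_def quad_gen_def sopp_homogeneous[OF assms])

text \<open>
  A representation on \<open>H \<otimes> U\<close> for a finite-dimensional superspace \<open>U\<close>, realised as a graded
  subspace of an ambient vector space.
\<close>

definition finite_conformal_representation where
  "finite_conformal_representation h C br s U \<rho> \<longleftrightarrow>
    super_module s U \<and> finite_dim s (super_carrier U) \<and>
    conformal_representation h C br (hscale s) (hgrade U) \<rho>"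

text \<open>
  Every finite-dimensional superspace is isomorphic to a graded subspace of this space of
  sequences, so restricting \<open>U\<close> to its subspaces loses nothing.
\<close>

definition seq_scale :: "'k::field \<Rightarrow> (nat \<Rightarrow> 'k) \<Rightarrow> nat \<Rightarrow> 'k" where
  "seq_scale t u = (\<lambda>n. t * u n)"

end

theory Submission
  imports Defs "HOL-Library.Product_Plus"
begin

text \<open>
  Let \<open>V\<close> be embedded in \<open>P\<^sup>(\<^sup>d\<^sup>)\<close>.  On functions of one variable \<open>t\<close> with values in \<open>P\<close> there is the
  Poisson bracket \<open>{f, g} + f\<^sub>t d(g) - d(f) g\<^sub>t\<close>, and \<open>L(V)\<close> is the formal-distribution form of the
  functions with values in \<open>V\<close>.  They act on all functions by Hamiltonian derivations; in terms of
  \<open>\<lambda>\<close>-brackets, a generator \<open>a\<close> acts on \<open>H \<otimes> P\<close> by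
  \<open>X\<^sub>\<lambda>(a) x = {a, x} + \<partial> (d(a) x) + \<lambda> d(a x)\<close>, and the same formula makes sense on \<open>H \<otimes> P\<^sup>1\<close>, where
  \<open>P\<^sup>1 = k + P\<close> has a unit adjoined.  For \<open>x\<close> in \<open>V\<close> this is the adjoint representation, which may
  have a kernel.  Multiplying functions by \<open>\<partial>\<^sub>t f\<close> commutes with Hamiltonian derivations up to the
  bracket, so \<open>X\<close> may be extended by the cocycle \<open>m \<mapsto> \<lambda> a m\<close>: the formula
  \<open>(m, x) \<mapsto> (X\<^sub>\<lambda>(a) m, X\<^sub>\<lambda>(a) x + \<lambda> a m)\<close> is a representation on \<open>H \<otimes> (P\<^sup>1 \<oplus> P)\<close>.  It is faithful
  on \<open>L(V)\<close>, because \<open>(1, 0)\<close> goes to a vector with second component \<open>\<lambda> a\<close>.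

  It remains to make it finite.  The pairs \<open>(m, x)\<close> with \<open>x \<in> V\<close> and \<open>V m \<subseteq> V\<close> span a
  subrepresentation that contains \<open>(1, 0)\<close>, since the Leibniz rules express \<open>v {a, m}\<close>,
  \<open>v d(a) m\<close> and \<open>v a d(m)\<close> by the operations of \<open>V\<close> and the map \<open>v \<mapsto> v m\<close>.  For the same reason
  the pairs with \<open>x = 0\<close> and \<open>V m = 0\<close> span a subrepresentation.  The quotient embeds into
  \<open>End(V) \<oplus> V\<close> by \<open>(m, x) \<mapsto> (v \<mapsto> v m, x)\<close>, so it is finite if \<open>V\<close> is finite-dimensional, and the
  vector \<open>\<lambda> a\<close> survives in it.

  The locale \<open>gd_action\<close> contains the identities that make three operators
  \<open>A a\<close>, \<open>B a\<close>, \<open>C a\<close> a representation \<open>A + \<partial> B + \<lambda> C\<close>; \<open>rep_generators\<close> and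
  \<open>nested_commutator_from_generators\<close> prove that they suffice, and applied to the adjoint operators
  (\<open>adjoint_action\<close>) they also give the Jacobi identity of \<open>L(V)\<close>.  The representation on
  \<open>P\<^sup>1 \<oplus> P\<close> is \<open>hamiltonian_action\<close>, the computation behind the two subrepresentations is
  \<open>mult_action\<close>, and \<open>subquotient\<close> passes to the quotient.
\<close>

section \<open>Additive maps and substitution of operators in polynomials\<close>

lemma ksgn_additive: "additive T \<Longrightarrow> T (ksgn i j x) = ksgn i j (T x)"
  by (simp add: ksgn_def additive.minus)

lemma ksgn_add: "ksgn i j (x + y) = ksgn i j x + ksgn i j (y :: 'm::ab_group_add)"
  by (simp add: ksgn_def)
lemma ksgn_minus: "ksgn i j (- x) = - ksgn i j (x :: 'm::ab_group_add)"
  by (simp add: ksgn_def)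
lemma ksgn_diff: "ksgn i j (x - y) = ksgn i j x - ksgn i j (y :: 'm::ab_group_add)"
  by (simp add: ksgn_def)

lemma subst_poly_bound:
  assumes T: "additive T" and \<iota>: "\<iota> 0 = 0" and N: "degree f \<le> N"
  shows "subst_poly T \<iota> f = (\<Sum>n\<le>N. (T ^^ n) (\<iota> (coeff f n)))"
proof -
  have z: "(T ^^ n) 0 = 0" for n
    by (induction n) (simp_all add: additive.zero[OF T])
  show ?thesis
    unfolding subst_poly_def using N
    by (intro sum.mono_neutral_left) (auto simp: coeff_eq_0 \<iota> z)
qed

lemma subst_poly_0 [simp]: "\<iota> 0 = 0 \<Longrightarrow> subst_poly T \<iota> 0 = 0"
  by (simp add: subst_poly_def)

text \<open>
  Together with the value at \<open>0\<close> this Horner rule determines \<open>subst_poly\<close> without reference to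
  degrees, so that everything else follows by induction on polynomials.
\<close>

lemma subst_poly_pCons:
  assumes T: "additive T" and \<iota>: "\<iota> 0 = 0"
  shows "subst_poly T \<iota> (pCons c f) = \<iota> c + T (subst_poly T \<iota> f)"
proof -
  have "subst_poly T \<iota> (pCons c f) = (\<Sum>n\<le>Suc (degree f). (T ^^ n) (\<iota> (coeff (pCons c f) n)))"
    by (rule subst_poly_bound) (simp_all add: T \<iota> degree_pCons_le)
  also have "\<dots> = \<iota> c + (\<Sum>n\<le>degree f. T ((T ^^ n) (\<iota> (coeff f n))))"
    by (simp add: sum.atMost_Suc_shift del: sum.atMost_Suc)
  also have "\<dots> = \<iota> c + T (subst_poly T \<iota> f)"
    unfolding subst_poly_def by (simp add: additive.sum[OF T])
  finally show ?thesis .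
qed

lemma additive_subst_poly:
  assumes T: "additive T" and \<iota>: "additive \<iota>"
  shows "additive (subst_poly T \<iota>)"
proof
  fix f g
  show "subst_poly T \<iota> (f + g) = subst_poly T \<iota> f + subst_poly T \<iota> g"
    by (induction f g rule: poly_induct2)
      (simp_all add: subst_poly_pCons[OF T] additive.zero[OF \<iota>] additive.add[OF \<iota>]
        additive.add[OF T] algebra_simps)
qed

lemma subst_poly_commute:
  assumes T: "additive T" and \<iota>: "\<iota> 0 = 0" and S: "additive S"
    and "\<And>x. S (T x) = T (S x)"
  shows "S (subst_poly T \<iota> f) = subst_poly T (\<lambda>x. S (\<iota> x)) f"
  by (induction f)
    (simp_all add: subst_poly_pCons[OF T] \<iota> additive.zero[OF S] additive.add[OF S] assms(4))

lemma subst_poly_map_poly: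
  assumes T: "additive T" and \<iota>: "\<iota> 0 = 0" and h: "h 0 = 0"
  shows "subst_poly T \<iota> (map_poly h f) = subst_poly T (\<lambda>x. \<iota> (h x)) f"
  by (induction f) (simp_all add: subst_poly_pCons[OF T] \<iota> h map_poly_pCons)

lemma subst_poly_add_fun:
  assumes T: "additive T" and "\<iota> 0 = 0" "\<kappa> 0 = 0"
  shows "subst_poly T (\<lambda>x. \<iota> x + \<kappa> x) f = subst_poly T \<iota> f + subst_poly T \<kappa> f"
  by (induction f) (simp_all add: subst_poly_pCons[OF T] assms additive.add[OF T])

lemma additive_map_poly:
  assumes "additive h"
  shows "additive (map_poly h)"
  by standard
    (auto intro!: poly_eqI simp: coeff_map_poly additive.zero[OF assms] additive.add[OF assms])

lemma map_poly_pCons_additive [simp]: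
  "additive h \<Longrightarrow> map_poly h (pCons a f) = pCons (h a) (map_poly h f)"
  by (simp add: map_poly_pCons additive.zero)

lemma additive_pCons0 [simp]: "additive (pCons 0)"
  by standard simp

lemma additive_uminus_fun: "additive f \<Longrightarrow> additive (\<lambda>x. - f x)"
  by (auto simp: additive_def)

lemma additive_add_fun: "additive f \<Longrightarrow> additive g \<Longrightarrow> additive (\<lambda>x. f x + g x)"
  by (auto simp: additive_def algebra_simps)

lemma additive_const_poly: "additive (\<lambda>c. [:c:])"
  by standard simp

text \<open>
  \<open>H \<otimes> V\<close> is generated by \<open>V\<close> under addition and \<open>\<partial>\<close>.  The set \<open>S\<close> keeps track of a homogeneous
  component.
\<close>

lemma poly_shift_induct [consumes 1, case_names const add shift]:
  assumes "\<And>n. coeff f n \<in> S"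
    and "\<And>a. a \<in> S \<Longrightarrow> P [:a:]"
    and "\<And>f g. P f \<Longrightarrow> P g \<Longrightarrow> P (f + g)"
    and "\<And>f. P f \<Longrightarrow> P (pCons 0 f)"
  shows "P (f :: 'a::ab_group_add poly)"
  using assms(1)
proof (induction f)
  case 0
  then have "P [:0:]" using assms(2)[of 0] by (metis coeff_0)
  then show ?case by simp
next
  case (pCons a f)
  have "coeff f n \<in> S" for n
    using pCons.prems[of "Suc n"] by simp
  then have "P f" by (rule pCons.IH)
  moreover have "a \<in> S" using pCons.prems[of 0] by simp
  ultimately have "P ([:a:] + pCons 0 f)"
    by (intro assms)
  then show ?case by simp
qed

section \<open>Sesqui-linear extension\<close>

text \<open>
  The construction of \<open>quad_bracket\<close> for an arbitrary bilinear map on generators, which covers the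
  representations as well.  In the values the outer variable is \<open>\<lambda>\<close> and the inner one is \<open>\<partial>\<close>.
\<close>

definition sesqui_extension ::
    "('a::ab_group_add \<Rightarrow> 'b::ab_group_add \<Rightarrow> 'b poly poly) \<Rightarrow> 'a poly \<Rightarrow> 'b poly \<Rightarrow> 'b poly poly" where
  "sesqui_extension q f g =
    subst_poly (\<lambda>u. - pCons 0 u)
      (\<lambda>a. subst_poly (\<lambda>u. map_poly (pCons 0) u + pCons 0 u) (q a) g) f"

lemma quad_bracket_eq_sesqui_extension:
  "quad_bracket V circ brk = sesqui_extension (quad_gen V circ brk)"
  by (intro ext) (simp add: quad_bracket_def sesqui_extension_def)

locale biadditive =
  fixes q :: "'a::ab_group_add \<Rightarrow> 'b::ab_group_add \<Rightarrow> 'c::ab_group_add"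
  assumes add_l: "q (a + b) x = q a x + q b x"
    and add_r: "q a (x + y) = q a x + q a y"
begin
lemma additive_l: "additive (\<lambda>a. q a x)" by standard (rule add_l)
lemma additive_r: "additive (q a)" by standard (rule add_r)
lemmas zero_l = additive.zero[OF additive_l] and zero_r = additive.zero[OF additive_r]
  and minus_l = additive.minus[OF additive_l] and minus_r = additive.minus[OF additive_r]
  and diff_l = additive.diff[OF additive_l] and diff_r = additive.diff[OF additive_r]
end

context
  fixes q :: "'a::ab_group_add \<Rightarrow> 'b::ab_group_add \<Rightarrow> 'b poly poly"
  assumes q: "biadditive q"
begin

interpretation biadditive q by (rule q)

lemma additive_minus_shift: "additive (\<lambda>u :: 'c::ab_group_add poly. - pCons 0 u)"
  by (intro additive_uminus_fun additive_pCons0)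

lemma additive_del_shift:
  "additive (\<lambda>u :: 'c::ab_group_add poly poly. map_poly (pCons 0) u + pCons 0 u)"
  by (intro additive_add_fun additive_pCons0 additive_map_poly)

lemma additive_sesqui_inner:
  "additive (subst_poly (\<lambda>u. map_poly (pCons 0) u + pCons 0 u) (q a))"
  by (intro additive_subst_poly additive_del_shift additive_r)

lemma biadditive_sesqui_inner:
  "biadditive (\<lambda>a. subst_poly (\<lambda>u. map_poly (pCons 0) u + pCons 0 u) (q a))"
proof
  fix a b :: 'a and x y :: "'b poly"
  let ?S = "\<lambda>a. subst_poly (\<lambda>u. map_poly (pCons 0) u + pCons 0 u) (q a)"
  have "q (a + b) = (\<lambda>x. q a x + q b x)"
    by (simp add: fun_eq_iff add_l)
  then show "?S (a + b) x = ?S a x + ?S b x"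
    by (simp add: subst_poly_add_fun[OF additive_del_shift] zero_r)
  show "?S a (x + y) = ?S a x + ?S a y"
    by (rule additive.add[OF additive_sesqui_inner])
qed

lemma biadditive_sesqui_extension: "biadditive (sesqui_extension q)"
proof
  interpret I: biadditive "\<lambda>a. subst_poly (\<lambda>u. map_poly (pCons 0) u + pCons 0 u) (q a)"
    by (rule biadditive_sesqui_inner)
  fix f f' :: "'a poly" and g g' :: "'b poly"
  show "sesqui_extension q (f + f') g = sesqui_extension q f g + sesqui_extension q f' g"
    unfolding sesqui_extension_def
    by (rule additive.add[OF additive_subst_poly[OF additive_minus_shift I.additive_l]])
  show "sesqui_extension q f (g + g') = sesqui_extension q f g + sesqui_extension q f g'"
    unfolding sesqui_extension_def
    by (simp add: I.add_r subst_poly_add_fun[OF additive_minus_shift] I.zero_l del: minus_pCons)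
qed

lemma sesqui_extension_const [simp]: "sesqui_extension q [:a:] [:x:] = q a x"
  by (simp add: sesqui_extension_def subst_poly_def)

lemma sesqui_extension_del_left [simp]:
  "sesqui_extension q (pCons 0 f) g = - pCons 0 (sesqui_extension q f g)"
proof -
  interpret I: biadditive "\<lambda>a. subst_poly (\<lambda>u. map_poly (pCons 0) u + pCons 0 u) (q a)"
    by (rule biadditive_sesqui_inner)
  show ?thesis
    unfolding sesqui_extension_def
    by (simp add: subst_poly_pCons[OF additive_minus_shift] I.zero_l del: minus_pCons)
qed

lemma sesqui_extension_del_right [simp]:
  "sesqui_extension q f (pCons 0 g) =
    map_poly (pCons 0) (sesqui_extension q f g) + pCons 0 (sesqui_extension q f g)"
proof -
  interpret I: biadditive "\<lambda>a. subst_poly (\<lambda>u. map_poly (pCons 0) u + pCons 0 u) (q a)"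
    by (rule biadditive_sesqui_inner)
  let ?D = "\<lambda>u. map_poly (pCons 0) u + pCons 0 u"
  have c: "?D (- pCons 0 u) = - pCons 0 (?D u)" for u :: "'b poly poly"
    by (simp add: additive.minus[OF additive_map_poly])
  have "?D (sesqui_extension q f g) =
      subst_poly (\<lambda>u. - pCons 0 u) (\<lambda>a. ?D (subst_poly ?D (q a) g)) f"
    unfolding sesqui_extension_def
    by (rule subst_poly_commute[where S = ?D, OF additive_minus_shift])
      (rule I.zero_l additive_del_shift c)+
  moreover have "subst_poly ?D (q a) (pCons 0 g) = ?D (subst_poly ?D (q a) g)" for a
    by (simp only: subst_poly_pCons[where \<iota> = "q a", OF additive_del_shift zero_r] zero_r add_0_left)
  ultimately show ?thesis
    by (simp only: sesqui_extension_def)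
qed

lemma sesqui_extension_linear:
  assumes h: "additive h" "additive k"
  shows "(\<And>a x. q (h a) x = map_poly (map_poly k) (q a x)) \<Longrightarrow>
      sesqui_extension q (map_poly h f) g = map_poly (map_poly k) (sesqui_extension q f g)"
    and "(\<And>a x. q a (k x) = map_poly (map_poly k) (q a x)) \<Longrightarrow>
      sesqui_extension q f (map_poly k g) = map_poly (map_poly k) (sesqui_extension q f g)"
proof -
  interpret S: biadditive "sesqui_extension q" by (rule biadditive_sesqui_extension)
  let ?K = "map_poly (map_poly k)"
  have K: "additive ?K" by (intro additive_map_poly h)
  have c: "?K (map_poly (pCons 0) u) = map_poly (pCons 0) (?K u)" for u
    by (intro poly_eqI) (simp add: coeff_map_poly coeff_pCons h additive.zero[OF h(2)] split: nat.split)
  note s = K h additive_map_poly additive.add[OF additive_map_poly[OF h(1)]] additive.add[OF K]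
    additive.add[OF additive_map_poly[OF h(2)]] additive.zero[OF h(1)] additive.zero[OF h(2)]
    S.add_l S.add_r additive.minus[OF K] c
  show "sesqui_extension q (map_poly h f) g = ?K (sesqui_extension q f g)"
    if "\<And>a x. q (h a) x = ?K (q a x)"
  proof -
    have "coeff f n \<in> UNIV" for n by simp
    then show ?thesis
    proof (induction f rule: poly_shift_induct)
      case (const a)
      have "coeff g n \<in> UNIV" for n by simp
      then show ?case
        by (induction g rule: poly_shift_induct) (simp_all add: s that)
    qed (simp_all add: s)
  qed
  show "sesqui_extension q f (map_poly k g) = ?K (sesqui_extension q f g)"
    if "\<And>a x. q a (k x) = ?K (q a x)"
  proof -
    have "coeff f n \<in> UNIV" for n by simp
    then show ?thesis
    proof (induction f rule: poly_shift_induct)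
      case (const a)
      have "coeff g n \<in> UNIV" for n by simp
      then show ?case
        by (induction g rule: poly_shift_induct) (simp_all add: s that)
    qed (simp_all add: s)
  qed
qed

text \<open>This is what gradings need: \<open>S\<close>, \<open>T\<close>, \<open>R\<close> are the components of degree \<open>i\<close>, \<open>j\<close>, \<open>i + j\<close>.\<close>

lemma coeff_sesqui_extension_in:
  assumes f: "\<And>n. coeff f n \<in> S" and g: "\<And>n. coeff g n \<in> T"
    and q: "\<And>a x m n. a \<in> S \<Longrightarrow> x \<in> T \<Longrightarrow> coeff (coeff (q a x) m) n \<in> R"
    and R: "0 \<in> R" "\<And>x y. x \<in> R \<Longrightarrow> y \<in> R \<Longrightarrow> x + y \<in> R" "\<And>x. x \<in> R \<Longrightarrow> - x \<in> R"
  shows "coeff (coeff (sesqui_extension q f g) m) n \<in> R"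
proof -
  interpret S: biadditive "sesqui_extension q" by (rule biadditive_sesqui_extension)
  have "\<forall>m n. coeff (coeff (sesqui_extension q f g) m) n \<in> R"
    using f
  proof (induction f rule: poly_shift_induct)
    case (const a)
    show ?case
      using g
      by (induction g rule: poly_shift_induct)
        (auto simp: S.add_r coeff_map_poly coeff_pCons q const R split: nat.split)
  qed (auto simp: S.add_l coeff_pCons R split: nat.split)
  then show ?thesis by blast
qed

end

section \<open>Reduction of the commutator identity to generators\<close>

lemma additive_emb2: "additive emb2"
  by standard (simp add: emb2_def)

lemma additive_mul_lam: "additive mul_lam"
  by standard (simp add: mul_lam_def)

lemma additive_mul_mu: "additive (mul_mu :: 'c::ab_group_add poly poly \<Rightarrow> _)"
  unfolding mul_mu_def[abs_def] by (rule additive_map_poly[OF additive_pCons0])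

abbreviation mul_lam_mu :: "'c::ab_group_add poly poly \<Rightarrow> 'c poly poly" where
  "mul_lam_mu g \<equiv> mul_lam g + mul_mu g"

lemma additive_mul_lam_mu: "additive mul_lam_mu"
  by (intro additive_add_fun additive_mul_lam additive_mul_mu)

text \<open>Three nested polynomials have the variables \<open>\<lambda>\<close>, \<open>\<mu>\<close>, \<open>\<partial>\<close>, from the outside to the inside.\<close>

abbreviation mul_del :: "'c::ab_group_add poly poly poly \<Rightarrow> 'c poly poly poly" where
  "mul_del \<equiv> map_poly (map_poly (pCons 0))"

lemma additive_mul_del: "additive mul_del"
  by (intro additive_map_poly additive_pCons0)

lemma mul_lam_mul_mu: "mul_lam (mul_mu u) = mul_mu (mul_lam u)" for u :: "'c::ab_group_add poly poly"
  by (simp add: mul_lam_def mul_mu_def)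

lemma mul_del_mul_lam: "mul_del (mul_lam u) = mul_lam (mul_del u)"
  by (simp add: mul_lam_def additive_map_poly)

lemma mul_del_mul_mu: "mul_del (mul_mu u) = mul_mu (mul_del u)"
  by (intro poly_eqI)
    (simp add: mul_mu_def coeff_map_poly coeff_pCons additive_map_poly split: nat.split)

lemmas mul_additive =
  additive_emb2 additive_mul_lam additive_mul_mu additive_mul_lam_mu additive_mul_del

lemmas mul_commute = mul_lam_mul_mu mul_del_mul_lam mul_del_mul_mu

context
  fixes q :: "'a::ab_group_add \<Rightarrow> 'b::ab_group_add \<Rightarrow> 'b poly poly"
  assumes q: "biadditive q"
begin

interpretation r: biadditive "sesqui_extension q" by (rule biadditive_sesqui_extension[OF q])

text \<open>The action with the operator \<open>T\<close> in the place of \<open>\<lambda>\<close>, as it occurs in \<open>nested\<close>.\<close>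

abbreviation (input) "act_with T f y \<equiv> subst_poly T emb2 (sesqui_extension q f y)"

lemma biadditive_act: "additive T \<Longrightarrow> biadditive (act_with T)"
  by standard
    (simp_all add: r.add_l r.add_r additive.add[OF additive_subst_poly[OF _ additive_emb2]])

lemma act_del_left:
  assumes "additive T" shows "act_with T (pCons 0 f) y = - T (act_with T f y)"
  using assms q
  by (simp add: additive.minus[OF additive_subst_poly[OF _ additive_emb2]]
      subst_poly_pCons additive.zero[OF additive_emb2] del: minus_pCons)

lemma act_del_right:
  assumes T: "additive T" and "\<And>u. mul_del (T u) = T (mul_del u)"
  shows "act_with T f (pCons 0 y) = mul_del (act_with T f y) + T (act_with T f y)"
proof -
  have "mul_del (subst_poly T emb2 u) = subst_poly T emb2 (map_poly (pCons 0) u)" for u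
    by (subst subst_poly_commute[OF T _ additive_mul_del assms(2)],
        simp add: emb2_def, subst subst_poly_map_poly[OF T])
      (simp_all add: emb2_def additive_map_poly)
  then show ?thesis
    using assms q
    by (simp add: additive.add[OF additive_subst_poly[OF _ additive_emb2]]
        subst_poly_pCons additive.zero[OF additive_emb2])
qed

lemma nested_eq_subst_poly: "nested T (sesqui_extension q f) T' (sesqui_extension q g) x =
    subst_poly T' (act_with T f) (sesqui_extension q g x)"
  by (simp add: nested_def)

context
  fixes T T' :: "'b poly poly poly \<Rightarrow> 'b poly poly poly"
  assumes T: "additive T" "additive T'"
    and c: "\<And>u. T (T' u) = T' (T u)"
    and D: "\<And>u. mul_del (T u) = T (mul_del u)" "\<And>u. mul_del (T' u) = T' (mul_del u)"
begin

interpretation E: biadditive "act_with T" by (rule biadditive_act[OF T(1)])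

lemma additive_subst_act: "additive (subst_poly T' (act_with T f))"
  by (intro additive_subst_poly T E.additive_r)

abbreviation (input) "nested_act f g x \<equiv> nested T (sesqui_extension q f) T' (sesqui_extension q g) x"

lemma nested_add:
  "nested_act (f + f') g x = nested_act f g x + nested_act f' g x"
  "nested_act f (g + g') x = nested_act f g x + nested_act f g' x"
  "nested_act f g (x + x') = nested_act f g x + nested_act f g x'"
proof -
  have "act_with T (f + f') = (\<lambda>y. act_with T f y + act_with T f' y)"
    by (simp add: fun_eq_iff E.add_l)
  then show "nested_act (f + f') g x = nested_act f g x + nested_act f' g x"
    unfolding nested_eq_subst_poly by (simp add: subst_poly_add_fun T E.zero_r)
qed (simp_all add: nested_eq_subst_poly r.add_l r.add_r additive.add[OF additive_subst_act])

text \<open>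
  The rules do not depend on which of \<open>\<lambda>\<close> and \<open>\<mu>\<close> belongs to the outer action.  Thus the two summands of
  the commutator react to \<open>\<partial>\<close> in any of the three arguments in the same way.
\<close>

lemma nested_del:
  "nested_act (pCons 0 f) g x = - T (nested_act f g x)"
  "nested_act f (pCons 0 g) x = - T' (nested_act f g x)"
  "nested_act f g (pCons 0 x) = mul_del (nested_act f g x) + T (nested_act f g x) + T' (nested_act f g x)"
proof -
  have mT: "additive (\<lambda>u. - T u)" by (intro additive_uminus_fun T)
  have DT: "additive (\<lambda>u. mul_del u + T u)"
    by (intro additive_add_fun additive_mul_del T)
  have cT: "- T (T' u) = T' (- T u)" for u
    by (simp add: c additive.minus[OF T(2)])
  have "- T (nested_act f g x) = subst_poly T' (\<lambda>y. - T (act_with T f y)) (sesqui_extension q g x)"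
    unfolding nested_eq_subst_poly
    by (rule subst_poly_commute[where S = "\<lambda>u. - T u", OF T(2)]) (rule E.zero_r mT cT)+
  then show "nested_act (pCons 0 f) g x = - T (nested_act f g x)"
    by (simp add: nested_eq_subst_poly act_del_left[OF T(1)])
  show "nested_act f (pCons 0 g) x = - T' (nested_act f g x)"
    using q by (simp add: nested_eq_subst_poly additive.minus[OF additive_subst_act] subst_poly_pCons[OF T(2)]
        E.zero_r del: minus_pCons)
  have cDT: "mul_del (T' u) + T (T' u) = T' (mul_del u + T u)" for u
    by (simp add: c D additive.add[OF T(2)])
  have "mul_del (nested_act f g x) + T (nested_act f g x) =
      subst_poly T' (\<lambda>y. mul_del (act_with T f y) + T (act_with T f y)) (sesqui_extension q g x)"
    unfolding nested_eq_subst_poly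
    by (rule subst_poly_commute[where S = "\<lambda>u. mul_del u + T u", OF T(2)]) (rule E.zero_r DT cDT)+
  moreover have "nested_act f g (pCons 0 x) =
      subst_poly T' (\<lambda>y. act_with T f (pCons 0 y)) (sesqui_extension q g x) + T' (nested_act f g x)"
    unfolding nested_eq_subst_poly sesqui_extension_del_right[OF q, of g]
    by (simp only: additive.add[OF additive_subst_act] subst_poly_pCons[OF T(2), of "act_with T f", OF E.zero_r]
        subst_poly_map_poly[OF T(2), of "act_with T f", OF E.zero_r] E.zero_r add_0_left pCons_0_0)
  ultimately show "nested_act f g (pCons 0 x) = mul_del (nested_act f g x) + T (nested_act f g x) + T' (nested_act f g x)"
    by (simp only: act_del_right[OF T(1) D(1)])
qed

end

abbreviation (input) "bracket_act u x \<equiv> lam_plus_mu (\<lambda>c. sesqui_extension q c x) u"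

lemma bracket_act_eq: "bracket_act u x = subst_poly mul_lam (\<lambda>c. act_with mul_lam_mu c x) u"
  by (simp add: lam_plus_mu_def)

interpretation E: biadditive "act_with mul_lam_mu" by (rule biadditive_act[OF additive_mul_lam_mu])

lemma additive_bracket_act: "additive (\<lambda>u. bracket_act u x)"
  unfolding bracket_act_eq by (intro additive_subst_poly mul_additive E.additive_l)

lemma bracket_act_add_right: "bracket_act u (x + y) = bracket_act u x + bracket_act u y"
  by (simp add: bracket_act_eq E.add_r subst_poly_add_fun mul_additive E.zero_l)

lemma bracket_act_shift: "bracket_act (pCons 0 u) x = mul_lam (bracket_act u x)"
  by (simp add: bracket_act_eq subst_poly_pCons mul_additive E.zero_l)

text \<open>
  Inside the bracket \<open>\<partial>\<close> acts on the left argument of the action with parameter \<open>\<lambda> + \<mu>\<close>, hence as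
  \<open>-\<lambda> - \<mu>\<close>.
\<close>

lemma bracket_act_del: "bracket_act (map_poly (pCons 0) u) x = - mul_lam (bracket_act u x) - mul_mu (bracket_act u x)"
proof -
  have a: "additive (\<lambda>u. - mul_lam_mu u)"
    by (intro additive_uminus_fun mul_additive)
  have c: "- mul_lam_mu (mul_lam u) = mul_lam (- mul_lam_mu u)" for u :: "'b poly poly poly"
    by (simp add: mul_commute additive.minus[OF additive_mul_lam] additive.diff[OF additive_mul_lam])
  have "- mul_lam_mu (bracket_act u x) = subst_poly mul_lam (\<lambda>c. - mul_lam_mu (act_with mul_lam_mu c x)) u"
    unfolding bracket_act_eq
    by (rule subst_poly_commute[where S = "\<lambda>u. - mul_lam_mu u", OF additive_mul_lam])
      (rule E.zero_l a c)+
  then show ?thesis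
    by (simp add: bracket_act_eq subst_poly_map_poly mul_additive E.zero_l act_del_left)
qed

lemma bracket_act_del_right: "bracket_act u (pCons 0 x) = mul_del (bracket_act u x) + mul_lam (bracket_act u x) + mul_mu (bracket_act u x)"
proof -
  let ?S = "\<lambda>u :: 'b poly poly poly. mul_del u + mul_lam_mu u"
  have a: "additive ?S"
    by (intro additive_add_fun mul_additive)
  have c: "mul_del (mul_lam_mu u) = mul_lam_mu (mul_del u)" for u :: "'b poly poly poly"
    by (simp add: mul_commute additive.add[OF additive_mul_del])
  have cS: "?S (mul_lam u) = mul_lam (?S u)" for u :: "'b poly poly poly"
    by (simp add: mul_commute additive.add[OF additive_mul_lam])
  have "?S (bracket_act u x) = subst_poly mul_lam (\<lambda>c. ?S (act_with mul_lam_mu c x)) u"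
    unfolding bracket_act_eq
    by (rule subst_poly_commute[where S = ?S, OF additive_mul_lam]) (rule E.zero_l a cS)+
  then show ?thesis
    by (simp add: bracket_act_eq act_del_right[OF additive_mul_lam_mu c] add.assoc)
qed

text \<open>
  Both sides are additive in \<open>f\<close>, \<open>g\<close>, \<open>x\<close>, and replacing \<open>f\<close>, \<open>g\<close>, \<open>x\<close> by \<open>\<partial> f\<close>, \<open>\<partial> g\<close>, \<open>\<partial> x\<close>
  multiplies both sides by \<open>-\<lambda>\<close>, \<open>-\<mu>\<close>, \<open>\<partial> + \<lambda> + \<mu>\<close>, respectively.  For \<open>p = q\<close> the identity is the
  Jacobi identity.
\<close>

lemma nested_commutator_from_generators:
  fixes p :: "'a \<Rightarrow> 'a \<Rightarrow> 'a poly poly"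
  assumes p: "biadditive p"
    and gen: "\<And>a b x. a \<in> S \<Longrightarrow> b \<in> S' \<Longrightarrow> x \<in> R \<Longrightarrow>
      nested mul_lam (sesqui_extension q [:a:]) mul_mu (sesqui_extension q [:b:]) [:x:]
      - ksgn i j (nested mul_mu (sesqui_extension q [:b:]) mul_lam (sesqui_extension q [:a:]) [:x:])
      = lam_plus_mu (\<lambda>c. sesqui_extension q c [:x:]) (p a b)"
    and f: "\<And>n. coeff f n \<in> S" and g: "\<And>n. coeff g n \<in> S'" and x: "\<And>n. coeff x n \<in> R"
  shows "nested mul_lam (sesqui_extension q f) mul_mu (sesqui_extension q g) x
      - ksgn i j (nested mul_mu (sesqui_extension q g) mul_lam (sesqui_extension q f) x)
      = lam_plus_mu (\<lambda>c. sesqui_extension q c x) (sesqui_extension p f g)"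
proof -
  interpret p: biadditive "sesqui_extension p" by (rule biadditive_sesqui_extension[OF p])
  note lm =
    nested_add[where T = mul_lam and T' = mul_mu,
        OF additive_mul_lam additive_mul_mu mul_commute]
    nested_add[where T = mul_mu and T' = mul_lam,
        OF additive_mul_mu additive_mul_lam mul_commute(1)[symmetric] mul_commute(3,2)]
    nested_del[where T = mul_lam and T' = mul_mu,
        OF additive_mul_lam additive_mul_mu mul_commute]
    nested_del[where T = mul_mu and T' = mul_lam,
        OF additive_mul_mu additive_mul_lam mul_commute(1)[symmetric] mul_commute(3,2)]
  have add3: "(x + y) - ksgn i j (x' + y') = (x - ksgn i j x') + (y - ksgn i j y')"
    for x y x' y' :: "'b poly poly poly"
    by (simp add: ksgn_add)
  have T: "T x - ksgn i j (T y) = T (x - ksgn i j y)" if "additive T"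
    for T and x y :: "'b poly poly poly"
    using that by (simp add: ksgn_additive additive.diff)
  have neg: "- x - ksgn i j (- y) = - (x - ksgn i j y)" for x y :: "'b poly poly poly"
    by (simp add: ksgn_minus)
  have D: "additive (\<lambda>u. mul_del u + mul_lam u + mul_mu u)"
    by (intro additive_add_fun mul_additive)
  show ?thesis
    using f
  proof (induction f rule: poly_shift_induct)
    case (const a)
    show ?case using g
    proof (induction g rule: poly_shift_induct)
      case (const b)
      show ?case using x
      proof (induction x rule: poly_shift_induct)
        case (const x)
        show ?case using gen[OF \<open>a \<in> S\<close> \<open>b \<in> S'\<close> const] p by simp
      next
        case (add f g)
        then show ?case by (simp only: lm add3 bracket_act_add_right)
      next
        case (shift f)
        show ?case
          by (simp only: bracket_act_del_right lm(9,12) shift[symmetric] T[OF D, symmetric])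
            (simp only: add_ac)
      qed
    next
      case (add f g)
      then show ?case by (simp only: lm add3 p.add_r additive.add[OF additive_bracket_act])
    next
      case (shift g)
      then show ?case using p
        by (simp only: lm neg T[OF additive_mul_mu] sesqui_extension_del_right additive.add[OF additive_bracket_act]
            bracket_act_shift bracket_act_del) simp
    qed
  next
    case (add f g)
    then show ?case by (simp only: lm add3 p.add_l additive.add[OF additive_bracket_act])
  next
    case (shift f)
    then show ?case using p
      by (simp only: lm neg T[OF additive_mul_lam] sesqui_extension_del_left additive.minus[OF additive_bracket_act] bracket_act_shift)
  qed
qed

end

section \<open>Homogeneous components and bilinear operations\<close>

lemma one_add_one_bit: "1 + 1 = (0::bit)"
  by simp

context full_super_module begin

lemma homogeneous_decomposition:
  obtains x0 x1 where "x = x0 + x1" "x0 \<in> G 0" "x1 \<in> G 1"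
proof -
  have "x \<in> super_carrier G" by (simp add: G_spans)
  then show ?thesis using that by (auto simp: super_carrier_def)
qed

lemma hcomp_add_homogeneous:
  assumes "x0 \<in> G 0" "x1 \<in> G 1"
  shows "hcomp G 0 (x0 + x1) = x0" "hcomp G 1 (x0 + x1) = x1"
proof -
  have *: "u = x0 \<and> v = x1" if "u \<in> G 0" "v \<in> G 1" "u + v = x0 + x1" for u v
  proof -
    have "u - x0 = x1 - v" using that(3) by (simp add: algebra_simps)
    moreover have "u - x0 \<in> G 0" "x1 - v \<in> G 1"
      using that(1,2) assms by (auto intro: subspace_diff[OF subspace_G])
    ultimately have "u - x0 \<in> {0}" unfolding G_independent[symmetric] by (metis IntI)
    then show ?thesis using that(3) by (metis add_left_imp_eq eq_iff_diff_eq_0 singletonD)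
  qed
  show "hcomp G 0 (x0 + x1) = x0"
    unfolding hcomp_def
  proof (rule the_equality)
    fix y assume "y \<in> G 0 \<and> x0 + x1 - y \<in> G (0 + 1)"
    then show "y = x0" using *[of y "x0 + x1 - y"] by (metis add_0 diff_add_cancel add.commute)
  qed (use assms in simp)
  show "hcomp G 1 (x0 + x1) = x1"
    unfolding hcomp_def
  proof (rule the_equality)
    fix y assume "y \<in> G 1 \<and> x0 + x1 - y \<in> G (1 + 1)"
    then show "y = x1" using *[of "x0 + x1 - y" y] by (metis one_add_one_bit diff_add_cancel)
  qed (use assms in simp)
qed

lemma hcomp_in: "hcomp G i x \<in> G i"
  and hcomp_sum: "hcomp G 0 x + hcomp G 1 x = x"
  and hcomp_add: "hcomp G i (x + y) = hcomp G i x + hcomp G i y"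
  and hcomp_scale: "hcomp G i (scale t x) = scale t (hcomp G i x)"
proof -
  obtain x0 x1 where x: "x = x0 + x1" "x0 \<in> G 0" "x1 \<in> G 1" by (rule homogeneous_decomposition)
  obtain y0 y1 where y: "y = y0 + y1" "y0 \<in> G 0" "y1 \<in> G 1" by (rule homogeneous_decomposition)
  note hx = hcomp_add_homogeneous[OF x(2,3)] and hy = hcomp_add_homogeneous[OF y(2,3)]
  show "hcomp G i x \<in> G i" using x hx by (cases i) auto
  show "hcomp G 0 x + hcomp G 1 x = x" by (simp add: x(1) hx)
  have "hcomp G 0 ((x0 + y0) + (x1 + y1)) = x0 + y0" "hcomp G 1 ((x0 + y0) + (x1 + y1)) = x1 + y1"
    by (rule hcomp_add_homogeneous; intro subspace_add[OF subspace_G] x(2,3) y(2,3))+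
  then show "hcomp G i (x + y) = hcomp G i x + hcomp G i y"
    unfolding x(1) y(1) by (cases i) (simp_all only: hx hy add.assoc add.left_commute[of x1 y0 y1])
  have "hcomp G 0 (scale t x0 + scale t x1) = scale t x0"
      "hcomp G 1 (scale t x0 + scale t x1) = scale t x1"
    by (rule hcomp_add_homogeneous; intro subspace_scale[OF subspace_G] x(2,3))+
  then show "hcomp G i (scale t x) = scale t (hcomp G i x)"
    unfolding x(1) by (cases i) (simp_all only: hx scale_right_distrib)
qed

lemma additive_hcomp: "additive (hcomp G i)"
  by standard (rule hcomp_add)

end

context superalgebra begin

sublocale mul: biadditive mul
  by standard
    (simp_all add: module_hom.add[OF linear_left] module_hom.add[OF linear_right])

lemma mul_scale: "mul (s t a) b = s t (mul a b)" "mul a (s t b) = s t (mul a b)"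
  by (simp_all add: module_hom.scale[OF linear_left] module_hom.scale[OF linear_right])

lemma scale_ksgn: "s t (ksgn i j x) = ksgn i j (s t x)"
  by (simp add: ksgn_def)

sublocale sopp: biadditive "sopp V mul"
  by standard
   (simp_all add: sopp_def hcomp_add mul.add_l mul.add_r ksgn_add add_ac)

lemma sopp_scale: "sopp V mul (s t a) b = s t (sopp V mul a b)"
    "sopp V mul a (s t b) = s t (sopp V mul a b)"
  by (simp_all add: sopp_def hcomp_scale mul_scale scale_ksgn scale_right_distrib)

lemma sopp_graded: "a \<in> V i \<Longrightarrow> b \<in> V j \<Longrightarrow> sopp V mul a b \<in> V (i + j)"
  using graded[of b j a i] subspace_neg[OF subspace_G]
  by (cases i; cases j) (simp_all add: sopp_homogeneous ksgn_def)

lemma module_homs: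
  "module_hom s s (\<lambda>a. mul a b)" "module_hom s s (mul a)"
  "module_hom s s (\<lambda>a. sopp V mul a b)" "module_hom s s (sopp V mul a)"
  by unfold_locales
    (simp_all add: mul.add_l mul.add_r mul_scale sopp.add_l sopp.add_r sopp_scale)

end

context gd_superalgebra begin

lemma superalgebra_circ: "superalgebra s V circ"
  by (rule novikov_superalgebra.axioms(1)[OF novikov_superalgebra_axioms])

lemma superalgebra_brk: "superalgebra s V brk"
  by (rule lie_superalgebra.axioms(1)[OF lie_superalgebra_axioms])

end

section \<open>Representations of the first order in \<open>\<partial>\<close> and \<open>\<lambda>\<close>\<close>

text \<open>The generator \<open>a\<close> acts by \<open>A a + \<partial> B a + \<lambda> C a\<close>.\<close>

definition action_gen ::
    "('v \<Rightarrow> 'w \<Rightarrow> 'w) \<Rightarrow> ('v \<Rightarrow> 'w \<Rightarrow> 'w) \<Rightarrow> ('v \<Rightarrow> 'w \<Rightarrow> 'w) \<Rightarrow> 'v \<Rightarrow> 'w::ab_group_add \<Rightarrow> 'w poly poly"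
  where "action_gen A B C a x = [:[:A a x, B a x:], [:C a x:]:]"

text \<open>
  The identities are the coefficients of \<open>1\<close>, \<open>\<partial>\<close>, \<open>\<partial>\<^sup>2\<close>, \<open>\<lambda>\<close>, \<open>\<lambda>\<^sup>2\<close>, \<open>\<lambda> \<mu>\<close> and \<open>\<lambda> \<partial>\<close>, in this order, of
  the bracket identity on generators.  The coefficients of \<open>\<mu>\<close>, \<open>\<mu>\<^sup>2\<close> and \<open>\<mu> \<partial>\<close> are those of \<open>\<lambda>\<close>,
  \<open>\<lambda>\<^sup>2\<close> and \<open>\<lambda> \<partial>\<close>, up to sign, with \<open>a\<close> and \<open>b\<close> exchanged.  Linearity is asked for on the whole type,
  so that the sesqui-linear extension is biadditive without side conditions.
\<close>

locale gd_action =
  gd_superalgebra s V circ brk + W: super_module sW W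
  for s :: "'k::field \<Rightarrow> 'v::ab_group_add \<Rightarrow> 'v" and V and circ (infixl "\<circ>\<^sub>N" 70) and brk
    and sW :: "'k \<Rightarrow> 'w::ab_group_add \<Rightarrow> 'w" and W +
  fixes A B C :: "'v \<Rightarrow> 'w \<Rightarrow> 'w"
  assumes linear_A: "module_hom s sW (\<lambda>a. A a x)" "module_hom sW sW (A a)"
    and linear_B: "module_hom s sW (\<lambda>a. B a x)" "module_hom sW sW (B a)"
    and linear_C: "module_hom s sW (\<lambda>a. C a x)" "module_hom sW sW (C a)"
    and graded_ops: "a \<in> V i \<Longrightarrow> x \<in> W j \<Longrightarrow> A a x \<in> W (i + j)"
      "a \<in> V i \<Longrightarrow> x \<in> W j \<Longrightarrow> B a x \<in> W (i + j)"
      "a \<in> V i \<Longrightarrow> x \<in> W j \<Longrightarrow> C a x \<in> W (i + j)"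
    and AA: "a \<in> V i \<Longrightarrow> b \<in> V j \<Longrightarrow> x \<in> W k \<Longrightarrow>
      A a (A b x) - ksgn i j (A b (A a x)) = A (brk a b) x"
    and AB: "a \<in> V i \<Longrightarrow> b \<in> V j \<Longrightarrow> x \<in> W k \<Longrightarrow>
      (A a (B b x) - ksgn i j (B b (A a x))) + (B a (A b x) - ksgn i j (A b (B a x))) = B (brk a b) x"
    and BB: "a \<in> V i \<Longrightarrow> b \<in> V j \<Longrightarrow> x \<in> W k \<Longrightarrow> B a (B b x) - ksgn i j (B b (B a x)) = 0"
    and AC: "a \<in> V i \<Longrightarrow> b \<in> V j \<Longrightarrow> x \<in> W k \<Longrightarrow>
      A a (B b x) + (C a (A b x) - ksgn i j (A b (C a x))) = C (brk a b) x + A (a \<circ>\<^sub>N b) x"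
    and CB: "a \<in> V i \<Longrightarrow> b \<in> V j \<Longrightarrow> x \<in> W k \<Longrightarrow> C a (B b x) = C (a \<circ>\<^sub>N b) x"
    and CC: "a \<in> V i \<Longrightarrow> b \<in> V j \<Longrightarrow> x \<in> W k \<Longrightarrow>
      C a (C b x) - ksgn i j (C b (C a x)) = C (a \<circ>\<^sub>N b) x - ksgn i j (C (b \<circ>\<^sub>N a) x)"
    and BC: "a \<in> V i \<Longrightarrow> b \<in> V j \<Longrightarrow> x \<in> W k \<Longrightarrow>
      B a (B b x) + (C a (B b x) - ksgn i j (B b (C a x))) = B (a \<circ>\<^sub>N b) x"
begin

sublocale A: biadditive A
  by standard (simp_all add: module_hom.add[OF linear_A(1)] module_hom.add[OF linear_A(2)])
sublocale B: biadditive B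
  by standard (simp_all add: module_hom.add[OF linear_B(1)] module_hom.add[OF linear_B(2)])
sublocale C: biadditive C
  by standard (simp_all add: module_hom.add[OF linear_C(1)] module_hom.add[OF linear_C(2)])

lemmas ops_scale =
  module_hom.scale[OF linear_A(1)] module_hom.scale[OF linear_A(2)]
  module_hom.scale[OF linear_B(1)] module_hom.scale[OF linear_B(2)]
  module_hom.scale[OF linear_C(1)] module_hom.scale[OF linear_C(2)]

lemma biadditive_action_gen: "biadditive (action_gen A B C)"
  by standard (simp_all add: action_gen_def A.add_l A.add_r B.add_l B.add_r C.add_l C.add_r)

abbreviation "rep \<equiv> sesqui_extension (action_gen A B C)"

abbreviation (input) "rep_at T f y \<equiv> subst_poly T emb2 (rep f y)"

lemma rep_at_generator:
  assumes "additive T"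
  shows "rep_at T [:a:] [:y:] = [:[:[:A a y, B a y:]:]:] + T [:[:[:C a y:]:]:]"
  using biadditive_action_gen
  by (simp add: action_gen_def subst_poly_pCons[OF assms] emb2_def additive.zero[OF assms]
      additive.add[OF assms])

lemma rep_at_linear:
  assumes T: "additive T" and D: "\<And>u. mul_del (T u) = T (mul_del u)"
  shows "rep_at T [:a:] [:y, z:] =
      rep_at T [:a:] [:y:] + mul_del (rep_at T [:a:] [:z:]) + T (rep_at T [:a:] [:z:])"
    and "rep_at T [:a, b:] [:y:] = rep_at T [:a:] [:y:] - T (rep_at T [:b:] [:y:])"
proof -
  interpret E: biadditive "rep_at T"
    by (rule biadditive_act[OF biadditive_action_gen T])
  have "[:y, z:] = [:y:] + pCons 0 [:z:]" "[:a, b:] = [:a:] + pCons 0 [:b:]" by simp_all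
  then show "rep_at T [:a:] [:y, z:] =
      rep_at T [:a:] [:y:] + mul_del (rep_at T [:a:] [:z:]) + T (rep_at T [:a:] [:z:])"
    and "rep_at T [:a, b:] [:y:] = rep_at T [:a:] [:y:] - T (rep_at T [:b:] [:y:])"
    by (simp_all only: E.add_l E.add_r act_del_right[OF biadditive_action_gen T D]
        act_del_left[OF biadditive_action_gen T] add.assoc diff_conv_add_uminus)
qed

text \<open>
  The bracket identity on generators is a comparison of the coefficients of polynomials of degree two
  in \<open>\<lambda>\<close>, \<open>\<mu>\<close>, \<open>\<partial>\<close>, all of which reduce to the identities of the locale.
\<close>

lemma rep_generators:
  assumes a: "a \<in> V i" and b: "b \<in> V j" and x: "x \<in> W k"
  shows "nested mul_lam (rep [:a:]) mul_mu (rep [:b:]) [:x:]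
      - ksgn i j (nested mul_mu (rep [:b:]) mul_lam (rep [:a:]) [:x:])
    = lam_plus_mu (\<lambda>c. rep c [:x:]) (quad_gen V circ brk a b)"
proof -
  have ji: "ksgn j i y = ksgn i j y" for y :: 'w
    by (auto simp: ksgn_def)
  have skew: "C (brk b a) x = - ksgn i j (C (brk a b) x)"
    using super_skew[OF b a] by (cases i; cases j) (simp_all add: ksgn_def C.minus_l)
  \<comment> \<open>The identities for \<open>(a, b)\<close> and \<open>(b, a)\<close>, solved for one term each so that they rewrite both
    sides of every coefficient to a normal form.\<close>
  have ids:
    "A (brk a b) x = A a (A b x) - ksgn i j (A b (A a x))"
    "B (brk a b) x = (A a (B b x) - ksgn i j (B b (A a x))) + (B a (A b x) - ksgn i j (A b (B a x)))"
    "A (circ a b) x = A a (B b x) + (C a (A b x) - ksgn i j (A b (C a x))) - C (brk a b) x"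
    "A (circ b a) x = A b (B a x) + (C b (A a x) - ksgn i j (A a (C b x))) + ksgn i j (C (brk a b) x)"
    "B (circ a b) x = B a (B b x) + (C a (B b x) - ksgn i j (B b (C a x)))"
    "B (circ b a) x = B b (B a x) + (C b (B a x) - ksgn i j (B a (C b x)))"
    "B a (B b x) = ksgn i j (B b (B a x))"
    "C (circ a b) x = C a (B b x)"
    "C (circ b a) x = C b (B a x)"
    "C a (C b x) = ksgn i j (C b (C a x)) + C a (B b x) - ksgn i j (C b (B a x))"
    using AA[OF a b x] AB[OF a b x] BB[OF a b x] AC[OF a b x] CB[OF a b x] CC[OF a b x]
      BC[OF a b x] AC[OF b a x] CB[OF b a x] BC[OF b a x]
    by (simp_all add: ji skew diff_eq_eq)
  have nested: "nested T (rep [:a:]) T' (rep [:b:]) [:x:] =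
      rep_at T [:a:] [:A b x, B b x:] + T' (rep_at T [:a:] [:C b x:])"
    if T: "additive T" "additive T'" for T T' a b
  proof -
    interpret E: biadditive "rep_at T"
      by (rule biadditive_act[OF biadditive_action_gen T(1)])
    show ?thesis
      using biadditive_action_gen
      by (simp add: nested_def action_gen_def subst_poly_pCons[OF T(2)] E.zero_r additive.zero[OF T(2)])
  qed
  interpret E: biadditive "rep_at mul_lam_mu"
    by (rule biadditive_act[OF biadditive_action_gen additive_mul_lam_mu])
  have K: "lam_plus_mu (\<lambda>c. rep c [:x:]) [:[:u, v:], [:w:]:] =
    rep_at mul_lam_mu [:u, v:] [:x:] + mul_lam (rep_at mul_lam_mu [:w:] [:x:])" for u v w
    by (simp add: lam_plus_mu_def subst_poly_pCons[OF additive_mul_lam] E.zero_l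
        additive.zero[OF additive_mul_lam])
  have c: "mul_del (mul_lam_mu u) = mul_lam_mu (mul_del u)" for u :: "'w poly poly poly"
    by (simp add: mul_commute additive.add[OF additive_mul_del])
  have q: "quad_gen V circ brk a b =
    [:[:brk a b, ksgn i j (circ b a):], [:ksgn i j (circ b a) + circ a b:]:]"
    by (simp add: quad_gen_def superalgebra.sopp_homogeneous[OF superalgebra_circ a b])
  show ?thesis
    unfolding q K nested[OF additive_mul_lam additive_mul_mu] nested[OF additive_mul_mu additive_mul_lam]
    unfolding rep_at_linear[OF additive_mul_lam mul_del_mul_lam]
      rep_at_linear[OF additive_mul_mu mul_del_mul_mu] rep_at_linear[OF additive_mul_lam_mu c]
      rep_at_generator[OF additive_mul_lam] rep_at_generator[OF additive_mul_mu]
      rep_at_generator[OF additive_mul_lam_mu]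
    by (simp add: mul_lam_def mul_mu_def additive_map_poly)
      (cases i; cases j; simp add: ksgn_def A.add_l B.add_l C.add_l A.minus_l B.minus_l C.minus_l
        A.diff_l B.diff_l C.diff_l ids algebra_simps)
qed

end

section \<open>The quadratic Lie conformal superalgebra\<close>

lemma module_map_poly:
  assumes "module s" shows "module (\<lambda>t. map_poly (s t))"
proof -
  interpret module s by fact
  show ?thesis
    by standard (auto intro!: poly_eqI simp: coeff_map_poly scale_right_distrib scale_left_distrib)
qed

lemma hscale_0 [simp]: "hscale s 0 f = 0"
  by (simp add: hscale_def)

lemma hscale_pCons:
  assumes "module s"
  shows "hscale s (pCons t p) f = map_poly (s t) f + pCons 0 (hscale s p f)"
proof (cases "t = 0 \<and> p = 0")
  case True
  interpret module s by fact
  have "map_poly (s 0) f = 0"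
    by (auto intro!: poly_eqI simp: coeff_map_poly)
  with True show ?thesis by (simp add: hscale_def)
next
  case False
  then have "fold_coeffs g (pCons t p) = g t \<circ> fold_coeffs g p"
    for g :: "'a \<Rightarrow> 'b poly \<Rightarrow> 'b poly"
    by auto
  then show ?thesis by (simp add: hscale_def)
qed

lemma module_hscale:
  assumes s: "module s" shows "module (hscale s)"
proof -
  interpret s: module s by fact
  interpret P: module "\<lambda>t. map_poly (s t)" by (rule module_map_poly[OF s])
  have add_r: "hscale s p (f + g) = hscale s p f + hscale s p g" for p f g
    by (induction p) (simp_all add: hscale_pCons[OF s] P.scale_right_distrib)
  have add_l: "hscale s (p + q) f = hscale s p f + hscale s q f" for p q f
    by (induction p q rule: poly_induct2) (simp_all add: hscale_pCons[OF s] P.scale_left_distrib)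
  have const: "hscale s (smult t q) f = map_poly (s t) (hscale s q f)" for t q f
    by (induction q) (simp_all add: hscale_pCons[OF s] P.scale_right_distrib map_poly_pCons)
  have pcons: "hscale s p (pCons 0 f) = pCons 0 (hscale s p f)" for p f
    by (induction p) (simp_all add: hscale_pCons[OF s] map_poly_pCons)
  have map: "hscale s p (map_poly (s t) f) = map_poly (s t) (hscale s p f)" for p t f
    by (induction p) (simp_all add: hscale_pCons[OF s] P.scale_right_distrib map_poly_pCons
        P.scale_left_commute[of t] mult.commute)
  have mult: "hscale s p (hscale s q f) = hscale s (p * q) f" for p q f
    by (induction p) (simp_all add: hscale_pCons[OF s] add_l const pcons map)
  show ?thesis
    by standard
      (simp_all add: add_r add_l mult hscale_pCons[OF s] one_pCons)
qed

lemma super_module_hgrade: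
  assumes "super_module s G" shows "super_module (hscale s) (hgrade G)"
proof -
  interpret super_module s G by fact
  interpret h: module "hscale s" by (rule module_hscale) unfold_locales
  have m: "module s" by unfold_locales
  have z: "0 \<in> G i" for i by (rule subspace_0[OF subspace_G])
  show ?thesis
  proof
    fix i
    have "hscale s p f \<in> hgrade G i" if "f \<in> hgrade G i" for p f
      using that by (induction p)
        (auto simp: hscale_pCons[OF m] hgrade_def coeff_map_poly coeff_pCons z
          intro!: subspace_add[OF subspace_G] subspace_scale[OF subspace_G] split: nat.split)
    then show "h.subspace (hgrade G i)"
      by (intro h.subspaceI) (auto simp: hgrade_def z subspace_add[OF subspace_G])
  next
    have "f = 0" if "f \<in> hgrade G 0" "f \<in> hgrade G 1" for f
    proof (rule poly_eqI)
      fix n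
      have "coeff f n \<in> G 0 \<inter> G 1" using that by (simp add: hgrade_def)
      then show "coeff f n = coeff 0 n" unfolding G_independent by simp
    qed
    moreover have "0 \<in> hgrade G i" for i by (simp add: hgrade_def z)
    ultimately show "hgrade G 0 \<inter> hgrade G 1 = {0}" by blast
  qed
qed

lemma full_super_module_hgrade:
  assumes "full_super_module s G" shows "full_super_module (hscale s) (hgrade G)"
proof -
  interpret full_super_module s G by fact
  interpret h: super_module "hscale s" "hgrade G" by (rule super_module_hgrade) unfold_locales
  have "f \<in> super_carrier (hgrade G)" for f
  proof -
    have "f = map_poly (hcomp G 0) f + map_poly (hcomp G 1) f"
      by (intro poly_eqI) (simp add: coeff_map_poly additive.zero[OF additive_hcomp] hcomp_sum)
    moreover have "map_poly (hcomp G i) f \<in> hgrade G i" for i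
      by (simp add: hgrade_def coeff_map_poly additive.zero[OF additive_hcomp] hcomp_in)
    ultimately show ?thesis unfolding super_carrier_def by blast
  qed
  then show ?thesis by unfold_locales auto
qed

text \<open>
  The coefficients of \<open>1\<close>, \<open>\<partial>\<close> and \<open>\<lambda>\<close> in \<open>[a \<^sub>\<lambda> x]\<close> are an action of \<open>V\<close> on itself: \<open>AA\<close> is the Jacobi
  identity, \<open>AB\<close> and \<open>AC\<close> are the compatibility of the two operations, \<open>BB\<close> is right commutativity, and
  \<open>CB\<close>, \<open>CC\<close>, \<open>BC\<close> follow from the two Novikov identities.
\<close>

lemma adjoint_action:
  fixes circ (infixl "\<circ>\<^sub>N" 70)
  assumes "gd_superalgebra s V circ brk"
  shows "gd_action s V circ brk s V brk (sopp V circ) (\<lambda>a b. sopp V circ a b + (a \<circ>\<^sub>N b))"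
proof -
  interpret circ: superalgebra s V circ by (rule gd_superalgebra.superalgebra_circ[OF assms])
  interpret brk: superalgebra s V brk by (rule gd_superalgebra.superalgebra_brk[OF assms])
  interpret gd_superalgebra s V circ brk by fact
  note lin = circ.mul.add_l circ.mul.add_r circ.mul.minus_l circ.mul.minus_r circ.mul.diff_l circ.mul.diff_r
    brk.mul.add_l brk.mul.add_r brk.mul.minus_l brk.mul.minus_r brk.mul.diff_l brk.mul.diff_r
    circ.sopp.add_l circ.sopp.add_r circ.sopp.minus_l circ.sopp.minus_r circ.sopp.diff_r
  show ?thesis
  proof (intro gd_action.intro gd_action_axioms.intro)
    show "gd_superalgebra s V circ brk" by fact
    show "super_module s V" by unfold_locales
  next
    fix a x
    show "module_hom s s (\<lambda>a. brk a x)" "module_hom s s (brk a)"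
      "module_hom s s (\<lambda>a. sopp V circ a x)" "module_hom s s (sopp V circ a)"
      by (rule brk.module_homs circ.module_homs)+
    show "module_hom s s (\<lambda>a. sopp V circ a x + (a \<circ>\<^sub>N x))"
      "module_hom s s (\<lambda>x. sopp V circ a x + (a \<circ>\<^sub>N x))"
      by (intro module_pair.module_hom_add[OF module_pair.intro] circ.module_axioms circ.module_homs)+
  next
    fix a x i j assume ax: "a \<in> V i" "x \<in> V j"
    show "brk a x \<in> V (i + j)" "sopp V circ a x \<in> V (i + j)"
      "sopp V circ a x + (a \<circ>\<^sub>N x) \<in> V (i + j)"
      by (intro circ.subspace_add[OF circ.subspace_G] brk.graded circ.sopp_graded circ.graded ax)+
  next
    fix a b x i j k assume a: "a \<in> V i" and b: "b \<in> V j" and x: "x \<in> V k"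
    note so = circ.sopp_homogeneous[OF a x] circ.sopp_homogeneous[OF b x]
      circ.sopp_homogeneous[OF a circ.graded[OF x b]] circ.sopp_homogeneous[OF b circ.graded[OF x a]]
      circ.sopp_homogeneous[OF a circ.graded[OF b x]] circ.sopp_homogeneous[OF b circ.graded[OF a x]]
      circ.sopp_homogeneous[OF a brk.graded[OF b x]] circ.sopp_homogeneous[OF b brk.graded[OF a x]]
      circ.sopp_homogeneous[OF brk.graded[OF a b] x]
      circ.sopp_homogeneous[OF circ.graded[OF a b] x] circ.sopp_homogeneous[OF circ.graded[OF b a] x]
    \<comment> \<open>Compatibility and left symmetry, solved for the right-nested product.\<close>
    have gd: "u \<circ>\<^sub>N brk v w = brk (u \<circ>\<^sub>N v) w + brk u v \<circ>\<^sub>N w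
        + ksgn l m (brk v (u \<circ>\<^sub>N w)) - ksgn m n (brk u w \<circ>\<^sub>N v)"
      if "u \<in> V l" "v \<in> V m" "w \<in> V n" for u v w l m n
      using gd_compatible[OF that] by (simp add: algebra_simps)
    have ls: "u \<circ>\<^sub>N (v \<circ>\<^sub>N w) =
        (u \<circ>\<^sub>N v) \<circ>\<^sub>N w - ksgn l m ((v \<circ>\<^sub>N u) \<circ>\<^sub>N w - v \<circ>\<^sub>N (u \<circ>\<^sub>N w))"
      if "u \<in> V l" "v \<in> V m" "w \<in> V n" for u v w l m n
      using left_symmetric[OF that] by (simp add: algebra_simps)
    note gds = gd[OF x a b] gd[OF a b x]
    note skews = super_skew[OF x a] super_skew[OF x b] super_skew[OF circ.graded[OF x a] b]
    note rcs = right_commutative[OF x b a] right_commutative[OF a x b] right_commutative[OF b x a]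
    note lss = ls[OF x a b] ls[OF x b a] ls[OF a b x]
    show "brk a (brk b x) - ksgn i j (brk b (brk a x)) = brk (brk a b) x"
      by (rule super_jacobi[OF a b x])
    show ab: "(brk a (sopp V circ b x) - ksgn i j (sopp V circ b (brk a x)))
        + (sopp V circ a (brk b x) - ksgn i j (brk b (sopp V circ a x))) = sopp V circ (brk a b) x"
      by (cases i; cases j; cases k; simp add: so gds skews ksgn_def lin)
    show "sopp V circ a (sopp V circ b x) - ksgn i j (sopp V circ b (sopp V circ a x)) = 0"
      by (cases i; cases j; cases k; simp add: so rcs ksgn_def lin)
    \<comment> \<open>After subtraction of \<open>AB\<close> the identity \<open>AC\<close> becomes the compatibility of \<open>a, b, x\<close>.\<close>
    have "brk a (sopp V circ b x)
        + (sopp V circ a (brk b x) + (a \<circ>\<^sub>N brk b x) - ksgn i j (brk b (sopp V circ a x + (a \<circ>\<^sub>N x))))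
        - sopp V circ (brk a b) x = (brk a b \<circ>\<^sub>N x) + brk (a \<circ>\<^sub>N b) x"
      unfolding ab[symmetric]
      by (cases i; cases j; cases k; simp add: so gds(2) ksgn_def lin)
    then show "brk a (sopp V circ b x)
        + (sopp V circ a (brk b x) + (a \<circ>\<^sub>N brk b x) - ksgn i j (brk b (sopp V circ a x + (a \<circ>\<^sub>N x))))
        = sopp V circ (brk a b) x + (brk a b \<circ>\<^sub>N x) + brk (a \<circ>\<^sub>N b) x"
      by (simp add: algebra_simps)
    show "sopp V circ a (sopp V circ b x) + (a \<circ>\<^sub>N sopp V circ b x) =
        sopp V circ (a \<circ>\<^sub>N b) x + ((a \<circ>\<^sub>N b) \<circ>\<^sub>N x)"
      by (cases i; cases j; cases k; simp add: so rcs lss ksgn_def lin)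
    show "sopp V circ a (sopp V circ b x + (b \<circ>\<^sub>N x)) + (a \<circ>\<^sub>N (sopp V circ b x + (b \<circ>\<^sub>N x)))
        - ksgn i j (sopp V circ b (sopp V circ a x + (a \<circ>\<^sub>N x)) + (b \<circ>\<^sub>N (sopp V circ a x + (a \<circ>\<^sub>N x))))
      = sopp V circ (a \<circ>\<^sub>N b) x + ((a \<circ>\<^sub>N b) \<circ>\<^sub>N x)
        - ksgn i j (sopp V circ (b \<circ>\<^sub>N a) x + ((b \<circ>\<^sub>N a) \<circ>\<^sub>N x))"
      by (cases i; cases j; cases k; simp add: so rcs lss ksgn_def lin)
    show "sopp V circ a (sopp V circ b x)
        + (sopp V circ a (sopp V circ b x) + (a \<circ>\<^sub>N sopp V circ b x)
          - ksgn i j (sopp V circ b (sopp V circ a x + (a \<circ>\<^sub>N x))))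
      = sopp V circ (a \<circ>\<^sub>N b) x"
      by (cases i; cases j; cases k; simp add: so rcs lss ksgn_def lin)
  qed
qed

lemma quad_gen_eq_action_gen:
  "quad_gen V circ brk = action_gen brk (sopp V circ) (\<lambda>a b. sopp V circ a b + circ a b)"
  by (intro ext) (simp add: quad_gen_def action_gen_def)

lemma kscale_hscale_fun: "module s \<Longrightarrow> kscale (hscale s) t = map_poly (s t)"
  by (intro ext) (rule kscale_hscale)

lemma del_hscale_fun: "module s \<Longrightarrow> del (hscale s) = pCons 0"
  by (intro ext) (rule del_hscale)

lemma additive_scale: "module s \<Longrightarrow> additive (s t)"
  by (simp add: additive_def module.scale_right_distrib)

context gd_action begin

lemma rep_linear:
  "rep (map_poly (s t) f) x = map_poly (map_poly (sW t)) (rep f x)"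
  "rep f (map_poly (sW t) x) = map_poly (map_poly (sW t)) (rep f x)"
  by (rule sesqui_extension_linear[where h = "s t", OF biadditive_action_gen];
      simp add: action_gen_def ops_scale additive_scale additive_map_poly module_axioms W.module_axioms)+

lemma rep_graded:
  assumes "f \<in> hgrade V i" "x \<in> hgrade W j"
  shows "coeff (rep f x) n \<in> hgrade W (i + j)"
proof -
  define R where "R = W (i + j)"
  have R: "W.subspace R" by (simp add: R_def W.subspace_G)
  have coeffs: "coeff (coeff [:[:p, q:], [:r:]:] m) n \<in> R" if "p \<in> R" "q \<in> R" "r \<in> R" for p q r m n
    using that W.subspace_0[OF R] by (auto simp: coeff_pCons split: nat.split)
  have "coeff (coeff (rep f x) n) m \<in> R" for m
  proof (rule coeff_sesqui_extension_in[OF biadditive_action_gen])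
    show "coeff f n \<in> V i" "coeff x n \<in> W j" for n
      using assms by (simp_all add: hgrade_def)
  next
    fix a x m n assume "a \<in> V i" "x \<in> W j"
    then show "coeff (coeff (action_gen A B C a x) m) n \<in> R"
      unfolding action_gen_def R_def by (intro coeffs[unfolded R_def] graded_ops)
  qed (rule W.subspace_0[OF R] W.subspace_add[OF R] W.subspace_neg[OF R]; assumption)+
  then show ?thesis by (simp add: hgrade_def R_def)
qed

end

context gd_superalgebra begin

interpretation adj: gd_action s V circ brk s V brk "sopp V circ" "\<lambda>a b. sopp V circ a b + (a \<circ>\<^sub>N b)"
  by (rule adjoint_action) unfold_locales

lemma quad_bracket_eq_adjoint: "quad_bracket V circ brk = adj.rep"
  by (simp add: quad_bracket_eq_sesqui_extension quad_gen_eq_action_gen)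

lemma biadditive_quad_gen: "biadditive (quad_gen V circ brk)"
  unfolding quad_gen_eq_action_gen by (rule adj.biadditive_action_gen)

text \<open>
  Under \<open>\<Phi>\<close>, the substitution of \<open>-\<partial> - \<lambda>\<close> for \<open>\<lambda>\<close>, the factors \<open>\<partial> + \<lambda>\<close> and \<open>-\<lambda>\<close> of the two arguments
  of the bracket are exchanged, which again reduces the claim to generators.
\<close>

lemma quad_bracket_skew:
  assumes f: "f \<in> hgrade V i" and g: "g \<in> hgrade V j"
  shows "quad_bracket V circ brk f g = - ksgn i j
      (subst_poly (\<lambda>u. - map_poly (pCons 0) u - pCons 0 u) (\<lambda>c. [:c:]) (quad_bracket V circ brk g f))"
proof -
  note q = adj.biadditive_action_gen
  interpret br: biadditive adj.rep
    by (rule biadditive_sesqui_extension[OF q])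
  define T :: "'v poly poly \<Rightarrow> 'v poly poly" where "T u = - map_poly (pCons 0) u - pCons 0 u" for u
  define \<Phi> where "\<Phi> = subst_poly T (\<lambda>c. [:c:])"
  have D: "additive (map_poly (pCons 0) :: 'v poly poly \<Rightarrow> _)"
    by (intro additive_map_poly additive_pCons0)
  have T: "additive T"
    by standard (simp add: T_def additive.add[OF D])
  have DT: "map_poly (pCons 0) (T u) = T (map_poly (pCons 0) u)" for u
    by (simp add: T_def additive.minus[OF D] additive.diff[OF D])
  have \<Phi>: "additive \<Phi>"
    unfolding \<Phi>_def by (rule additive_subst_poly[OF T additive_const_poly])
  have \<Phi>_shift: "\<Phi> (pCons 0 u) = T (\<Phi> u)" for u
    by (simp add: \<Phi>_def subst_poly_pCons[OF T])
  have \<Phi>_del: "\<Phi> (map_poly (pCons 0) u) = map_poly (pCons 0) (\<Phi> u)" for u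
    unfolding \<Phi>_def
    by (subst subst_poly_commute[OF T _ D DT]) (simp_all add: subst_poly_map_poly[OF T])
  have fc: "coeff f n \<in> V i" and gc: "coeff g n \<in> V j" for n
    using f g by (simp_all add: hgrade_def)
  have rep_const: "adj.rep [:a:] [:b:] =
      [:[:brk a b, sopp V circ a b:], [:sopp V circ a b + (a \<circ>\<^sub>N b):]:]" for a b
    unfolding sesqui_extension_const[OF q] by (simp add: action_gen_def)
  have "adj.rep f g = - ksgn i j (\<Phi> (adj.rep g f))"
    using fc
  proof (induction f rule: poly_shift_induct)
    case (const a)
    show ?case using gc
    proof (induction g rule: poly_shift_induct)
      case (const b)
      have "brk a b = - ksgn i j (brk b a)"
        by (rule super_skew[OF \<open>a \<in> V i\<close> const])
      moreover note superalgebra.sopp_homogeneous[OF superalgebra_circ \<open>a \<in> V i\<close> const]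
        superalgebra.sopp_homogeneous[OF superalgebra_circ const \<open>a \<in> V i\<close>]
      ultimately show ?case
        unfolding rep_const
        by (cases i; cases j; simp add: \<Phi>_def subst_poly_pCons[OF T]
            additive.zero[OF T] ksgn_def T_def)
    next
      case (add g g')
      then show ?case by (simp add: br.add_l br.add_r additive.add[OF \<Phi>] ksgn_add)
    next
      case (shift g)
      then show ?case using q
        by (simp add: \<Phi>_shift additive.minus[OF \<Phi>] ksgn_minus ksgn_add ksgn_diff
           T_def ksgn_additive[OF D] additive.minus[OF D] ksgn_additive[OF additive_pCons0]
          additive.minus[OF additive_pCons0] del: minus_pCons)
    qed
  next
    case (add f f')
    then show ?case by (simp add: br.add_l br.add_r additive.add[OF \<Phi>] ksgn_add)
  next
    case (shift f)
    then show ?case using q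
      by (simp add: \<Phi>_shift \<Phi>_del additive.add[OF \<Phi>] ksgn_minus ksgn_add ksgn_diff
          T_def ksgn_additive[OF D] ksgn_additive[OF additive_pCons0]
          additive.minus[OF additive_pCons0] del: minus_pCons)
  qed
  then show ?thesis
    unfolding quad_bracket_eq_adjoint \<Phi>_def T_def[abs_def] .
qed

theorem lie_conformal_quad_bracket:
  "lie_conformal_superalgebra (hscale s) (hgrade V) (quad_bracket V circ brk)"
proof -
  have m: "module s" by unfold_locales
  interpret h: full_super_module "hscale s" "hgrade V"
    by (rule full_super_module_hgrade) unfold_locales
  note q = adj.biadditive_action_gen
  interpret br: biadditive adj.rep
    by (rule biadditive_sesqui_extension[OF q])
  note mm = module_map_poly[OF m] module_map_poly[OF module_map_poly[OF m]]
  show ?thesis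
  proof (intro lie_conformal_superalgebra.intro lie_conformal_superalgebra_axioms.intro)
    show "full_super_module (hscale s) (hgrade V)" by unfold_locales
  next
    fix x y
    show "module_hom (kscale (hscale s)) (\<lambda>t. map_poly (kscale (hscale s) t)) (\<lambda>x. quad_bracket V circ brk x y)"
      "module_hom (kscale (hscale s)) (\<lambda>t. map_poly (kscale (hscale s) t)) (\<lambda>y. quad_bracket V circ brk x y)"
      unfolding kscale_hscale_fun[OF m, abs_def] quad_bracket_eq_adjoint module_hom_def module_hom_axioms_def
      using mm by (simp_all add: br.add_l br.add_r adj.rep_linear)
    show "quad_bracket V circ brk (del (hscale s) x) y = - pCons 0 (quad_bracket V circ brk x y)"
      "quad_bracket V circ brk x (del (hscale s) y) =
        map_poly (del (hscale s)) (quad_bracket V circ brk x y) + pCons 0 (quad_bracket V circ brk x y)"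
      using q by (simp_all add: del_hscale_fun[OF m] quad_bracket_eq_adjoint)
  next
    fix x y i j n assume "x \<in> hgrade V i" "y \<in> hgrade V j"
    then show "coeff (quad_bracket V circ brk x y) n \<in> hgrade V (i + j)"
      unfolding quad_bracket_eq_adjoint by (rule adj.rep_graded)
  next
    fix x y i j assume "x \<in> hgrade V i" "y \<in> hgrade V j"
    then show "quad_bracket V circ brk x y = - ksgn i j
       (subst_poly (\<lambda>g. - map_poly (del (hscale s)) g - pCons 0 g) (\<lambda>c. [:c:]) (quad_bracket V circ brk y x))"
      unfolding del_hscale_fun[OF m] by (rule quad_bracket_skew)
  next
    fix x y z i j k assume "x \<in> hgrade V i" "y \<in> hgrade V j" "z \<in> hgrade V k"
    then show "nested mul_lam (quad_bracket V circ brk x) mul_mu (quad_bracket V circ brk y) z -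
       ksgn i j (nested mul_mu (quad_bracket V circ brk y) mul_lam (quad_bracket V circ brk x) z) =
       lam_plus_mu (\<lambda>c. quad_bracket V circ brk c z) (quad_bracket V circ brk x y)"
      unfolding quad_bracket_eq_adjoint hgrade_def
      by (intro nested_commutator_from_generators[OF q q, where S = "V i" and S' = "V j" and R = "V k"]
          adj.rep_generators[unfolded quad_gen_eq_action_gen]) auto
  qed
qed

end

theorem (in gd_action) conformal_representation_rep:
  "conformal_representation (hscale s) (hgrade V) (quad_bracket V circ brk) (hscale sW) (hgrade W) rep"
proof -
  have m: "module s" "module sW" by unfold_locales
  note q = biadditive_action_gen
  interpret br: biadditive rep
    by (rule biadditive_sesqui_extension[OF q])
  show ?thesis
  proof (intro conformal_representation.intro conformal_representation_axioms.intro)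
    show "lie_conformal_superalgebra (hscale s) (hgrade V) (quad_bracket V circ brk)"
      by (rule lie_conformal_quad_bracket)
    show "super_module (hscale sW) (hgrade W)"
      by (rule super_module_hgrade) unfold_locales
  next
    fix a b x i j k assume "a \<in> hgrade V i" "b \<in> hgrade V j" "x \<in> hgrade W k"
    then show "nested mul_lam (rep a) mul_mu (rep b) x - ksgn i j (nested mul_mu (rep b) mul_lam (rep a) x) =
       lam_plus_mu (\<lambda>c. rep c x) (quad_bracket V circ brk a b)"
      unfolding quad_bracket_eq_sesqui_extension hgrade_def
      by (intro nested_commutator_from_generators[OF q biadditive_quad_gen, where S = "V i" and S' = "V j" and R = "W k"]
          rep_generators) auto
  next
    fix a x i j n assume "a \<in> hgrade V i" "x \<in> hgrade W j"
    then show "coeff (rep a x) n \<in> hgrade W (i + j)"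
      by (rule rep_graded)
  qed (use q in \<open>simp_all add: br.add_l br.add_r rep_linear kscale_hscale_fun[OF m(1)]
    kscale_hscale_fun[OF m(2)] del_hscale_fun[OF m(1)] del_hscale_fun[OF m(2)]\<close>)
qed

section \<open>The Hamiltonian action on the Poisson superalgebra\<close>

locale gd_embedding =
  V: gd_superalgebra s V circ brk + pm: superalgebra sP P mul + pb: superalgebra sP P pb +
  P: poisson_superalgebra_derivation sP P mul pb d
  for s :: "'k::field \<Rightarrow> 'v::ab_group_add \<Rightarrow> 'v" and V and circ and brk
    and sP :: "'k \<Rightarrow> 'p::ab_group_add \<Rightarrow> 'p" and P and mul (infixl "\<cdot>" 70) and pb and d +
  fixes \<phi> :: "'v \<Rightarrow> 'p"
  assumes phi_linear: "module_hom s sP \<phi>"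
    and phi_graded: "a \<in> V i \<Longrightarrow> \<phi> a \<in> P i"
    and phi_circ: "\<phi> (circ a b) = \<phi> a \<cdot> d (\<phi> b)"
    and phi_brk: "\<phi> (brk a b) = pb (\<phi> a) (\<phi> b)"
begin

lemma d_graded: "a \<in> P i \<Longrightarrow> d a \<in> P i"
  using P.d_even by blast

lemma additive_d: "additive d"
  using module_hom.add[OF P.d_linear] by (simp add: additive_def)
lemma additive_phi: "additive \<phi>"
  using module_hom.add[OF phi_linear] by (simp add: additive_def)

lemmas d_simps = additive.add[OF additive_d] additive.minus[OF additive_d] additive.diff[OF additive_d]
  additive.zero[OF additive_d] module_hom.scale[OF P.d_linear] P.d_mul P.d_pb
lemmas phi_simps = additive.add[OF additive_phi] additive.minus[OF additive_phi]
  additive.diff[OF additive_phi] additive.zero[OF additive_phi] module_hom.scale[OF phi_linear]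
  phi_circ phi_brk

text \<open>The signs of the Leibniz rule do not involve the degree of \<open>c\<close>.\<close>

lemma leibniz_any:
  assumes a: "a \<in> P i" and b: "b \<in> P j"
  shows "pb a (b \<cdot> c) = pb a b \<cdot> c + ksgn i j (b \<cdot> pb a c)"
proof -
  obtain c0 c1 where c: "c = c0 + c1" "c0 \<in> P 0" "c1 \<in> P 1" by (rule pm.homogeneous_decomposition)
  show ?thesis
    using P.leibniz[OF a b c(2)] P.leibniz[OF a b c(3)]
    by (simp add: c(1) pm.mul.add_r pb.mul.add_r ksgn_add algebra_simps)
qed

lemma leibniz_left:
  assumes a: "a \<in> P i" and b: "b \<in> P j" and c: "c \<in> P k"
  shows "pb (a \<cdot> b) c = a \<cdot> pb b c + ksgn j i (b \<cdot> pb a c)"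
proof -
  have "pb (a \<cdot> b) c = - ksgn (i + j) k (pb c (a \<cdot> b))"
    by (rule P.super_skew[OF pm.graded[OF a b] c])
  also have "\<dots> = - ksgn (i + j) k (pb c a \<cdot> b + ksgn k i (a \<cdot> pb c b))"
    by (simp add: P.leibniz[OF c a b])
  also have "\<dots> = a \<cdot> pb b c + ksgn j i (b \<cdot> pb a c)"
    using P.super_skew[OF c a] P.super_skew[OF c b] P.super_commutative[OF pb.graded[OF a c] b]
    by (cases i; cases j; cases k; simp add: ksgn_def pm.mul.minus_l pm.mul.minus_r algebra_simps)
  finally show ?thesis .
qed

text \<open>
  The space \<open>P\<^sup>1 \<oplus> P\<close> consists of the triples \<open>(r, m, x)\<close>, which stand for the pairs \<open>(r + m, x)\<close>; the
  unit is even.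
\<close>

definition ext_scale :: "'k \<Rightarrow> 'k \<times> 'p \<times> 'p \<Rightarrow> 'k \<times> 'p \<times> 'p" where
  "ext_scale t = (\<lambda>(r, m, x). (t * r, sP t m, sP t x))"

definition ext_grade :: "bit \<Rightarrow> ('k \<times> 'p \<times> 'p) set" where
  "ext_grade i = {(r, m, x). (i = 1 \<longrightarrow> r = 0) \<and> m \<in> P i \<and> x \<in> P i}"

text \<open>
  The coefficients of \<open>1\<close>, \<open>\<partial>\<close> and \<open>\<lambda>\<close> of the action of \<open>a\<close>.  On both components they are
  \<open>{a, _}\<close>, \<open>d(a) _\<close> and \<open>d(a _)\<close>, where \<open>{a, 1} = 0\<close> and \<open>d(a 1) = d(a)\<close>; besides, \<open>C a\<close> contains the
  cocycle, multiplication by \<open>a\<close> from the first component to the second.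
\<close>

definition A :: "'v \<Rightarrow> 'k \<times> 'p \<times> 'p \<Rightarrow> 'k \<times> 'p \<times> 'p" where
  "A a = (\<lambda>(r, m, x). (0, pb (\<phi> a) m, pb (\<phi> a) x))"

definition B :: "'v \<Rightarrow> 'k \<times> 'p \<times> 'p \<Rightarrow> 'k \<times> 'p \<times> 'p" where
  "B a = (\<lambda>(r, m, x). (0, sP r (d (\<phi> a)) + d (\<phi> a) \<cdot> m, d (\<phi> a) \<cdot> x))"

definition C :: "'v \<Rightarrow> 'k \<times> 'p \<times> 'p \<Rightarrow> 'k \<times> 'p \<times> 'p" where
  "C a = (\<lambda>(r, m, x). (0, sP r (d (\<phi> a)) + d (\<phi> a \<cdot> m), d (\<phi> a \<cdot> x) + sP r (\<phi> a) + \<phi> a \<cdot> m))"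

lemma super_module_ext: "super_module ext_scale ext_grade"
proof -
  interpret E: module ext_scale
    by standard (auto simp: ext_scale_def split_beta algebra_simps pm.scale_right_distrib
        pm.scale_left_distrib prod_eq_iff)
  note G = pm.subspace_G
  have "(r, m, x) = 0" if "(r, m, x) \<in> ext_grade 0" "(r, m, x) \<in> ext_grade 1" for r m x
  proof -
    have "m \<in> P 0 \<inter> P 1" "x \<in> P 0 \<inter> P 1" "r = 0" using that by (auto simp: ext_grade_def)
    then show ?thesis unfolding pm.G_independent by (simp add: zero_prod_def)
  qed
  moreover have 0: "0 \<in> ext_grade i" for i
    by (simp add: ext_grade_def zero_prod_def pm.subspace_0[OF G])
  ultimately have "ext_grade 0 \<inter> ext_grade 1 = {0}" by fastforce
  moreover have "E.subspace (ext_grade i)" for i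
    by (intro E.subspaceI 0)
      (auto simp: ext_grade_def ext_scale_def pm.subspace_add[OF G] pm.subspace_scale[OF G])
  ultimately show ?thesis by unfold_locales
qed

text \<open>
  \<open>AA\<close> is the Jacobi identity.  The others follow from the Leibniz rules: once all derivatives and
  brackets of products have been expanded and the factors have been put into the order \<open>a, b, m\<close>, both
  sides agree.
\<close>

lemma hamiltonian_action: "gd_action s V circ brk ext_scale ext_grade A B C"
proof (intro gd_action.intro gd_action_axioms.intro)
  show "gd_superalgebra s V circ brk" by unfold_locales
  show "super_module ext_scale ext_grade" by (rule super_module_ext)
next
  interpret E: super_module ext_scale ext_grade by (rule super_module_ext)
  have hom: "module_hom s ext_scale f"
    if "\<And>a b. f (a + b) = f a + f b" "\<And>t a. f (s t a) = ext_scale t (f a)" for f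
    using that by unfold_locales auto
  have hom': "module_hom ext_scale ext_scale f"
    if "\<And>a b. f (a + b) = f a + f b" "\<And>t a. f (ext_scale t a) = ext_scale t (f a)" for f
    using that by unfold_locales auto
  note lin = phi_simps d_simps pm.mul.add_l pm.mul.add_r pb.mul.add_l pb.mul.add_r
    pm.mul_scale pb.mul_scale pm.scale_right_distrib pm.scale_left_distrib pm.scale_left_commute
  fix a x
  show "module_hom s ext_scale (\<lambda>a. A a x)" "module_hom ext_scale ext_scale (A a)"
    "module_hom s ext_scale (\<lambda>a. B a x)" "module_hom ext_scale ext_scale (B a)"
    "module_hom s ext_scale (\<lambda>a. C a x)" "module_hom ext_scale ext_scale (C a)"
    by (rule hom hom'; simp add: A_def B_def C_def ext_scale_def split_beta lin add_ac mult.commute)+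
next
  fix a x i j assume a: "a \<in> V i" and x: "x \<in> ext_grade j"
  note G = pm.subspace_G
  obtain r m y where e: "x = (r, m, y)" by (cases x)
  have my: "m \<in> P j" "y \<in> P j" and r: "j = 1 \<longrightarrow> r = 0" using x by (auto simp: e ext_grade_def)
  have ra: "u \<in> P i \<Longrightarrow> sP r u \<in> P (i + j)" for u
    using r pm.subspace_scale[OF G] pm.subspace_0[OF G] by (cases j) auto
  note in_P = phi_graded[OF a] my ra d_graded pm.graded pb.graded pm.subspace_add[OF G]
  show "A a x \<in> ext_grade (i + j)" "B a x \<in> ext_grade (i + j)" "C a x \<in> ext_grade (i + j)"
    unfolding ext_grade_def A_def B_def C_def e by (simp_all only: prod.case mem_Collect_eq, safe)
      (intro in_P)+
next
  fix a' b' x i j k assume a': "a' \<in> V i" and b': "b' \<in> V j" and x: "x \<in> ext_grade k"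
  define a b where "a = \<phi> a'" and "b = \<phi> b'"
  have a: "a \<in> P i" and b: "b \<in> P j" by (simp_all add: a_def b_def phi_graded a' b')
  obtain r m y where e: "x = (r, m, y)" by (cases x)
  have my: "m \<in> P k" "y \<in> P k" using x by (auto simp: e ext_grade_def)
  note da = d_graded[OF a] and db = d_graded[OF b]
  have comm3: "v \<cdot> (u \<cdot> z) = ksgn i j (u \<cdot> (v \<cdot> z))" if "u \<in> P i" "v \<in> P j" for u v z
    using P.super_commutative[OF that(2,1)] by (simp add: ksgn_def P.mul_assoc[symmetric] pm.mul.minus_l)
  note defs = A_def B_def C_def e phi_brk phi_circ a_def[symmetric] b_def[symmetric]
  note lin = d_simps pm.mul.add_l pm.mul.add_r pb.mul.add_l pb.mul.add_r
    pm.mul_scale pb.mul_scale pm.scale_right_distrib pm.mul.minus_l pm.mul.minus_r pb.mul.minus_l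
    pb.mul.minus_r pm.mul.diff_l pm.mul.diff_r pb.mul.diff_l pb.mul.diff_r
    pm.scale_right_diff_distrib pm.mul.zero_l pm.mul.zero_r pb.mul.zero_l pb.mul.zero_r P.mul_assoc
  note comm = comm3[OF a b] comm3[OF da b] comm3[OF a db] comm3[OF da db] comm3[OF d_graded[OF da] b]
    P.super_commutative[OF b d_graded[OF da]]
    P.super_commutative[OF b a] P.super_commutative[OF b da] P.super_commutative[OF db a]
    P.super_commutative[OF db da]
  note skew = P.super_skew[OF b a] P.super_skew[OF b da]
  note jac = P.super_jacobi[OF a b my(1), symmetric] P.super_jacobi[OF a b my(2), symmetric]
  note leib = leibniz_any[OF a b] leibniz_any[OF a db] leibniz_any[OF b a] leibniz_any[OF b da]
    leibniz_left[OF a db my(1)] leibniz_left[OF a db my(2)]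
  show "A a' (A b' x) - ksgn i j (A b' (A a' x)) = A (brk a' b') x"
    by (simp add: defs jac ksgn_def)
  show "(A a' (B b' x) - ksgn i j (B b' (A a' x))) + (B a' (A b' x) - ksgn i j (A b' (B a' x))) =
      B (brk a' b') x"
    by (cases i; cases j; simp add: defs lin leib skew ksgn_def)
  show "B a' (B b' x) - ksgn i j (B b' (B a' x)) = 0"
    by (cases i; cases j; simp add: defs lin comm ksgn_def zero_prod_def)
  show "A a' (B b' x) + (C a' (A b' x) - ksgn i j (A b' (C a' x))) = C (brk a' b') x + A (circ a' b') x"
    by (cases i; cases j; simp add: defs lin leib skew comm ksgn_def)
  show "C a' (B b' x) = C (circ a' b') x"
    by (simp add: defs lin)
  show "C a' (C b' x) - ksgn i j (C b' (C a' x)) = C (circ a' b') x - ksgn i j (C (circ b' a') x)"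
    by (cases i; cases j; simp add: defs lin comm ksgn_def)
  show "B a' (B b' x) + (C a' (B b' x) - ksgn i j (B b' (C a' x))) = B (circ a' b') x"
    by (cases i; cases j; simp add: defs lin comm ksgn_def)
qed

end

context gd_embedding begin

section \<open>Multipliers\<close>

text \<open>The product of \<open>v\<close> and the first component of \<open>w\<close>.\<close>

definition mult :: "'k \<times> 'p \<times> 'p \<Rightarrow> 'v \<Rightarrow> 'p" where
  "mult = (\<lambda>(r, m, x) v. sP r (\<phi> v) + \<phi> v \<cdot> m)"

text \<open>
  The multiplication operator of \<open>{a, m}\<close> is, up to sign, the commutator of \<open>{a, _}\<close> with that of
  \<open>m\<close>, and the one of \<open>a d(m)\<close> is the commutator of \<open>a d(_)\<close> with that of \<open>m\<close>.  The formulas express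
  the new operators by the old one and operations of \<open>V\<close>.
\<close>

lemma mult_action:
  assumes a: "a \<in> V i" and v: "v \<in> V l"
  shows mult_A: "mult (A a w) v = ksgn i l (pb (\<phi> a) (mult w v) - mult w (brk a v))"
    and mult_B: "mult (B a w) v = mult w (circ v a)"
    and mult_C: "mult (C a w) v = mult w (circ v a) + ksgn i l (\<phi> a \<cdot> d (mult w v) - mult w (circ a v))"
proof -
  obtain r m x where w: "w = (r, m, x)" by (cases w)
  note fa = phi_graded[OF a] and fv = phi_graded[OF v]
  note lin = d_simps pm.mul.add_l pm.mul.add_r pb.mul.add_l pb.mul.add_r
    pm.mul_scale pb.mul_scale pm.scale_right_distrib pm.mul.minus_l pm.mul.minus_r pm.mul.zero_r
  have comm: "\<phi> a \<cdot> (\<phi> v \<cdot> z) = ksgn i l (\<phi> v \<cdot> (\<phi> a \<cdot> z))" for z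
    using P.super_commutative[OF fa fv] by (simp add: ksgn_def P.mul_assoc[symmetric] pm.mul.minus_l)
  show "mult (A a w) v = ksgn i l (pb (\<phi> a) (mult w v) - mult w (brk a v))"
    by (cases i; cases l;
        simp add: w mult_def A_def phi_brk lin leibniz_any[OF fa fv] ksgn_def)
  show "mult (B a w) v = mult w (circ v a)"
    by (simp add: w mult_def B_def phi_circ lin P.mul_assoc)
  show "mult (C a w) v = mult w (circ v a) + ksgn i l (\<phi> a \<cdot> d (mult w v) - mult w (circ a v))"
    by (cases i; cases l; simp add: w mult_def C_def phi_circ lin P.mul_assoc comm ksgn_def)
qed

definition multipliers :: "bit \<Rightarrow> ('k \<times> 'p \<times> 'p) set" where
  "multipliers i = {w \<in> ext_grade i. (\<forall>v. mult w v \<in> range \<phi>) \<and> snd (snd w) \<in> range \<phi>}"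

lemma additive_mult: "additive (mult w)"
  by (cases w) (simp add: additive_def mult_def phi_simps pm.mul.add_l pm.scale_right_distrib)

lemma mult_linear: "module_hom ext_scale sP (\<lambda>w. mult w v)"
proof -
  interpret E: super_module ext_scale ext_grade by (rule super_module_ext)
  show ?thesis
    unfolding module_hom_def module_hom_axioms_def
    using E.module_axioms pm.module_axioms
    by (simp add: mult_def ext_scale_def split_beta pm.mul.add_r pm.mul_scale
        pm.scale_right_distrib pm.scale_left_distrib add_ac)
qed

lemma subspace_range: "module.subspace sP (range \<phi>)"
  by (rule module_hom.subspace_image[OF phi_linear V.subspace_UNIV])

lemma in_subspace_by_homogeneous:
  assumes R: "module.subspace sP R" and f: "additive f" and "\<And>l v. v \<in> V l \<Longrightarrow> f v \<in> R"
  shows "f v \<in> R"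
proof -
  obtain v0 v1 where "v = v0 + v1" "v0 \<in> V 0" "v1 \<in> V 1"
    by (rule V.homogeneous_decomposition)
  then show ?thesis
    using assms by (simp add: additive.add[OF f] pm.subspace_add)
qed

text \<open>
  For \<open>R = range \<phi>\<close> this is the stability of the subrepresentation of multipliers of \<open>V\<close>, and for
  \<open>R = {0}\<close> that of the subrepresentation which is factored out.
\<close>

lemma multiplier_stable:
  assumes a: "a \<in> V i" and R: "module.subspace sP R"
    and closed: "\<And>y. y \<in> R \<Longrightarrow> pb (\<phi> a) y \<in> R" "\<And>y. y \<in> R \<Longrightarrow> \<phi> a \<cdot> d y \<in> R"
      "\<And>y. y \<in> R \<Longrightarrow> d (\<phi> a) \<cdot> y \<in> R"
    and w: "\<And>v. mult w v \<in> R" "snd (snd w) \<in> R"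
  shows "mult (A a w) v \<in> R" "snd (snd (A a w)) \<in> R"
    "mult (B a w) v \<in> R" "snd (snd (B a w)) \<in> R"
    "mult (C a w) v \<in> R" "snd (snd (C a w)) \<in> R"
proof -
  note sub = pm.subspace_add[OF R] pm.subspace_diff[OF R] pm.subspace_neg[OF R]
  note intros = sub closed w
  have ks: "ksgn p q y \<in> R" if "y \<in> R" for p q y
    using that sub by (simp add: ksgn_def)
  have "mult (A a w) v \<in> R" if "v \<in> V l" for v l
    unfolding mult_A[OF a that] by (intro ks intros)
  then show "mult (A a w) v \<in> R" by (rule in_subspace_by_homogeneous[OF R additive_mult])
  have "mult (B a w) v \<in> R" if "v \<in> V l" for v l
    unfolding mult_B[OF a that] by (intro ks intros)
  then show "mult (B a w) v \<in> R" by (rule in_subspace_by_homogeneous[OF R additive_mult])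
  have "mult (C a w) v \<in> R" if "v \<in> V l" for v l
    unfolding mult_C[OF a that] by (intro ks intros)
  then show "mult (C a w) v \<in> R" by (rule in_subspace_by_homogeneous[OF R additive_mult])
  obtain r m x where e: "w = (r, m, x)" by (cases w)
  have x: "x \<in> R" using w by (simp add: e)
  show "snd (snd (A a w)) \<in> R" "snd (snd (B a w)) \<in> R"
    using closed x by (simp_all add: A_def B_def e)
  have "snd (snd (C a w)) = (d (\<phi> a) \<cdot> x + \<phi> a \<cdot> d x) + mult w a"
    by (simp add: C_def e mult_def P.d_mul)
  also have "\<dots> \<in> R" by (intro intros x)
  finally show "snd (snd (C a w)) \<in> R" .
qed

lemma range_closed:
  assumes a: "a \<in> V i" and y: "y \<in> range \<phi>"
  shows "pb (\<phi> a) y \<in> range \<phi>" "\<phi> a \<cdot> d y \<in> range \<phi>" "d (\<phi> a) \<cdot> y \<in> range \<phi>"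
proof -
  obtain u where u: "y = \<phi> u" using y by auto
  show "pb (\<phi> a) y \<in> range \<phi>" "\<phi> a \<cdot> d y \<in> range \<phi>"
    unfolding u phi_brk[symmetric] phi_circ[symmetric] by simp_all
  have "d (\<phi> a) \<cdot> \<phi> v = ksgn i l (\<phi> (circ v a))" if "v \<in> V l" for v l
    unfolding phi_circ by (rule P.super_commutative[OF d_graded[OF phi_graded[OF a]] phi_graded[OF that]])
  moreover have "ksgn p q (\<phi> z) \<in> range \<phi>" for p q z
    using pm.subspace_neg[OF subspace_range] by (simp add: ksgn_def)
  ultimately have "d (\<phi> a) \<cdot> \<phi> v \<in> range \<phi>" if "v \<in> V l" for v l
    using that by simp
  moreover have "additive (\<lambda>v. d (\<phi> a) \<cdot> \<phi> v)"
    by (simp add: additive_def phi_simps pm.mul.add_r)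
  ultimately show "d (\<phi> a) \<cdot> y \<in> range \<phi>"
    unfolding u
    by (rule in_subspace_by_homogeneous[where f = "\<lambda>v. d (\<phi> a) \<cdot> \<phi> v", OF subspace_range, rotated])
qed

lemma zero_closed:
  "pb (\<phi> a) 0 = 0" "\<phi> a \<cdot> d 0 = 0" "d (\<phi> a) \<cdot> 0 = 0"
  by (simp_all add: d_simps pm.mul.zero_r pb.mul.zero_r)

lemma multipliers_closed:
  assumes a: "a \<in> V i" and w: "w \<in> multipliers j"
  shows "A a w \<in> multipliers (i + j)" "B a w \<in> multipliers (i + j)" "C a w \<in> multipliers (i + j)"
proof -
  have wg: "w \<in> ext_grade j" and wr: "mult w v \<in> range \<phi>" "snd (snd w) \<in> range \<phi>" for v
    using w by (auto simp: multipliers_def)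
  note gd_action.graded_ops[OF hamiltonian_action a wg]
  moreover note multiplier_stable[OF a subspace_range range_closed[OF a] wr]
  ultimately show "A a w \<in> multipliers (i + j)" "B a w \<in> multipliers (i + j)" "C a w \<in> multipliers (i + j)"
    by (auto simp: multipliers_def)
qed

definition annihilates :: "'k \<times> 'p \<times> 'p \<Rightarrow> bool" where
  "annihilates w \<longleftrightarrow> (\<forall>v. mult w v = 0) \<and> snd (snd w) = 0"

lemma annihilates_closed:
  assumes a: "a \<in> V i" and "annihilates w"
  shows "annihilates (A a w)" "annihilates (B a w)" "annihilates (C a w)"
proof -
  have w: "mult w v \<in> {0}" "snd (snd w) \<in> {0}" for v using assms by (auto simp: annihilates_def)
  have "pb (\<phi> a) y \<in> {0}" "\<phi> a \<cdot> d y \<in> {0}" "d (\<phi> a) \<cdot> y \<in> {0}" if "y \<in> {0}" for y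
    using that zero_closed by auto
  from multiplier_stable[OF a pm.subspace_single_0 this w]
  show "annihilates (A a w)" "annihilates (B a w)" "annihilates (C a w)"
    by (auto simp: annihilates_def)
qed

text \<open>The annihilating triples form a graded subspace, so that the quotient by them is graded.\<close>

lemma annihilates_homogeneous:
  assumes w: "w \<in> ext_grade 0" "w' \<in> ext_grade 1" and "annihilates (w + w')"
  shows "annihilates w"
proof -
  obtain r m x r' m' x' where e: "w = (r, m, x)" "w' = (r', m', x')" by (cases w, cases w')
  have g: "m \<in> P 0" "x \<in> P 0" "m' \<in> P 1" "x' \<in> P 1" "r' = 0" using w by (auto simp: e ext_grade_def)
  have indep: "u = 0" if "u \<in> P i" "u' \<in> P (i + 1)" "u + u' = 0" for u u' i
  proof -
    have "u = - u'" using that(3) by (simp add: eq_neg_iff_add_eq_0)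
    then have "u \<in> P (i + 1)" using that(2) pm.subspace_neg[OF pm.subspace_G] by simp
    then have "u \<in> P 0 \<inter> P 1" using that(1) by (cases i) auto
    then show ?thesis unfolding pm.G_independent by simp
  qed
  have x: "x = 0"
  proof (rule indep)
    show "x \<in> P 0" "x' \<in> P (0 + 1)" using g by simp_all
    show "x + x' = 0" using assms(3) by (simp add: annihilates_def e)
  qed
  have m0: "mult w v \<in> {0}" if v: "v \<in> V l" for v l
    unfolding singleton_iff
  proof (rule indep)
    have fv: "\<phi> v \<in> P l" by (rule phi_graded[OF v])
    show "mult w v \<in> P l"
      unfolding e mult_def prod.case
      using pm.graded[OF fv g(1)] unfolding add_0_right
      by (intro pm.subspace_add[OF pm.subspace_G] pm.subspace_scale[OF pm.subspace_G fv])
    show "mult w' v \<in> P (l + 1)"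
      unfolding e mult_def prod.case g(5) using pm.graded[OF fv g(3)]
      by (simp only: pm.scale_zero_left add_0_left)
    show "mult w v + mult w' v = 0"
      using assms(3) module_hom.add[OF mult_linear, of w w' v] by (simp add: annihilates_def)
  qed
  have "mult w v \<in> {0}" for v
    by (rule in_subspace_by_homogeneous[OF pm.subspace_single_0 additive_mult m0])
  then show ?thesis by (simp add: annihilates_def e x)
qed

lemma subspace_multipliers: "module.subspace ext_scale (multipliers i)"
proof -
  interpret E: super_module ext_scale ext_grade by (rule super_module_ext)
  note sub = pm.subspace_0[OF subspace_range] pm.subspace_add[OF subspace_range] pm.subspace_scale[OF subspace_range]
  note mlin = module_hom.zero[OF mult_linear] module_hom.add[OF mult_linear] module_hom.scale[OF mult_linear]
  have x_comp: "snd (snd (ext_scale c w)) = sP c (snd (snd w))" for c w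
    by (simp add: ext_scale_def split_beta)
  show ?thesis
    by (rule E.subspaceI)
      (use E.subspace_0[OF E.subspace_G] E.subspace_add[OF E.subspace_G] E.subspace_scale[OF E.subspace_G]
        in \<open>simp_all add: multipliers_def mlin sub x_comp\<close>)
qed

end

section \<open>Finite-dimensional spaces of sequences\<close>

lemma vector_space_seq_scale: "vector_space seq_scale"
  by unfold_locales (auto simp: seq_scale_def algebra_simps)

lemma finite_dim_subspace:
  assumes "vector_space s" and "finite F" and S: "module.subspace s S" "S \<subseteq> module.span s F"
  shows "finite_dim s S"
proof -
  interpret vector_space s by fact
  obtain B where B: "B \<subseteq> S" "independent B" "S \<subseteq> span B"
    by (rule maximal_independent_subset)
  then have "finite B"
    using independent_span_bound[OF \<open>finite F\<close>] S by auto
  moreover have "span B = S"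
    using B span_minimal[OF B(1) S(1)] by auto
  ultimately show ?thesis unfolding finite_dim_def by blast
qed

lemma finite_support_in_span:
  fixes u :: "nat \<Rightarrow> 'k::field"
  assumes "\<And>n. n \<ge> N \<Longrightarrow> u n = 0"
  shows "u \<in> module.span seq_scale ((\<lambda>n m. if m = n then 1 else 0) ` {..<N})"
proof -
  interpret vector_space "seq_scale :: 'k \<Rightarrow> _" by (rule vector_space_seq_scale)
  let ?e = "\<lambda>n m. if m = n then 1 else (0 :: 'k)"
  have "u = (\<Sum>n<N. seq_scale (u n) (?e n))"
  proof
    fix m
    have "(\<Sum>n<N. seq_scale (u n) (?e n)) m = (\<Sum>n<N. seq_scale (u n) (?e n) m)"
      by (induction N) simp_all
    also have "\<dots> = (\<Sum>n<N. if m = n then u n else 0)"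
      by (intro sum.cong) (auto simp: seq_scale_def)
    also have "\<dots> = u m"
      using assms by (simp add: not_less)
    finally show "u m = (\<Sum>n<N. seq_scale (u n) (?e n)) m" by simp
  qed
  also have "\<dots> \<in> span (?e ` {..<N})"
    by (intro span_sum span_scale span_base) auto
  finally show ?thesis .
qed

text \<open>
  The coordinates of the finitely many vectors \<open>q w\<close> are finitely many linear functionals, and
  \<open>\<kappa>\<close> lists their values.  This realises \<open>'w\<close> modulo the common kernel of \<open>Q\<close> as a
  finite-dimensional space of sequences.
\<close>

lemma sequence_coordinates:
  fixes s :: "'k::field \<Rightarrow> 'v::ab_group_add \<Rightarrow> 'v" and sW :: "'k \<Rightarrow> 'w::ab_group_add \<Rightarrow> 'w"
  assumes s: "vector_space s" and sW: "vector_space sW" and fd: "finite_dim s (UNIV :: 'v set)"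
    and Q: "finite Q" "\<And>q. q \<in> Q \<Longrightarrow> module_hom sW s q"
  obtains \<kappa> F where "module_hom sW seq_scale \<kappa>" "\<And>w. \<kappa> w = 0 \<longleftrightarrow> (\<forall>q\<in>Q. q w = 0)"
    "finite F" "range \<kappa> \<subseteq> module.span seq_scale F"
proof -
  interpret vector_space s by (rule s)
  obtain F where F: "finite F" "span F = UNIV" using fd unfolding finite_dim_def by auto
  obtain B where "B \<subseteq> UNIV" and indep: "independent B" and "UNIV \<subseteq> span B"
    by (rule maximal_independent_subset)
  then have B: "independent B" "span B = UNIV"
    using indep by (blast intro: top.extremum_uniqueI)+
  have "finite B"
    using independent_span_bound[OF F(1) indep] by (simp add: F(2))
  then have "finite ((\<lambda>(q, b) w. representation B (q w) b) ` (Q \<times> B))" (is "finite ?L")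
    using Q by simp
  from finite_list[OF this] obtain fs where fs: "set fs = ?L" ..
  define \<kappa> where "\<kappa> w = (\<lambda>n. if n < length fs then (fs ! n) w else 0)" for w
  have fs_linear: "f (w + w') = f w + f w' \<and> f (sW t w) = t * f w" if "f \<in> set fs" for f w w' t
  proof -
    obtain q b where qb: "q \<in> Q" "f = (\<lambda>w. representation B (q w) b)" using \<open>f \<in> set fs\<close> fs by auto
    have "\<And>x. x \<in> span B" by (simp add: B)
    then show ?thesis
      using module_hom.add[OF Q(2)[OF qb(1)]] module_hom.scale[OF Q(2)[OF qb(1)]]
      by (simp add: qb(2) representation_add[OF B(1)] representation_scale[OF B(1)])
  qed
  show thesis
  proof
    show "module_hom sW seq_scale \<kappa>"
      unfolding module_hom_def module_hom_axioms_def module_iff_vector_space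
      using sW vector_space_seq_scale fs_linear[OF nth_mem] by (auto simp: \<kappa>_def seq_scale_def fun_eq_iff)
    show "\<kappa> w = 0 \<longleftrightarrow> (\<forall>q\<in>Q. q w = 0)" for w
    proof -
      have "\<kappa> w = 0 \<longleftrightarrow> (\<forall>n<length fs. (fs ! n) w = 0)"
        by (auto simp: \<kappa>_def fun_eq_iff)
      also have "\<dots> \<longleftrightarrow> (\<forall>f\<in>set fs. f w = 0)"
        by (metis in_set_conv_nth)
      also have "\<dots> \<longleftrightarrow> (\<forall>q\<in>Q. \<forall>b\<in>B. representation B (q w) b = 0)"
        unfolding fs by auto
      also have "\<dots> \<longleftrightarrow> (\<forall>q\<in>Q. q w = 0)"
      proof -
        have "v = 0" if "\<forall>b\<in>B. representation B v b = 0" for v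
          using sum_representation_eq[OF B(1) _ \<open>finite B\<close> subset_refl, of v] that B(2) by simp
        then show ?thesis by (auto simp: representation_zero)
      qed
      finally show ?thesis .
    qed
    show "range \<kappa> \<subseteq> module.span seq_scale ((\<lambda>n m. if m = n then 1 else 0) ` {..<length fs})"
      by (auto intro!: finite_support_in_span simp: \<kappa>_def)
  qed simp
qed

section \<open>Subquotients and faithfulness\<close>

lemma subspace_super_carrier:
  assumes "vector_space s" and "\<And>i. module.subspace s (N i)"
  shows "module.subspace s (super_carrier N)"
  unfolding super_carrier_def by (rule vector_space.subspace_sums[OF assms(1) assms(2) assms(2)])

text \<open>
  The quotient of \<open>N\<close> by the kernel of \<open>\<kappa>\<close> is realised as the image of \<open>\<kappa>\<close>.  The operators on it
  must be linear on the whole of the type \<open>'u\<close>, so they are defined by means of a linear right inverse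
  of \<open>\<kappa>\<close>; on the image its choice is irrelevant because the kernel is stable.
\<close>

lemma (in gd_action) subquotient:
  fixes sU :: "'k \<Rightarrow> 'u::ab_group_add \<Rightarrow> 'u"
  assumes N: "\<And>i. W.subspace (N i)" "\<And>i. N i \<subseteq> W i"
    and closed: "\<And>a i x j. a \<in> V i \<Longrightarrow> x \<in> N j \<Longrightarrow>
        A a x \<in> N (i + j) \<and> B a x \<in> N (i + j) \<and> C a x \<in> N (i + j)"
    and \<kappa>: "module_hom sW sU \<kappa>"
    and ker: "\<And>a i x. a \<in> V i \<Longrightarrow> x \<in> super_carrier N \<Longrightarrow> \<kappa> x = 0 \<Longrightarrow>
        \<kappa> (A a x) = 0 \<and> \<kappa> (B a x) = 0 \<and> \<kappa> (C a x) = 0"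
    and ker_graded: "\<And>x y. x \<in> N 0 \<Longrightarrow> y \<in> N 1 \<Longrightarrow> \<kappa> (x + y) = 0 \<Longrightarrow> \<kappa> x = 0"
  obtains A' B' C' where "gd_action s V circ brk sU (\<lambda>i. \<kappa> ` N i) A' B' C'"
    "\<And>a j x. x \<in> N j \<Longrightarrow> C' a (\<kappa> x) = \<kappa> (C a x)"
proof -
  interpret k: module_hom sW sU \<kappa> by (rule \<kappa>)
  have lin: "Vector_Spaces.linear sW sU \<kappa>" using \<kappa> by (simp add: module_hom_iff_linear)
  interpret vector_space_pair sW sU
    using lin by (simp add: vector_space_pair_def Vector_Spaces.linear_def)
  have sub: "W.subspace (super_carrier N)"
    by (rule subspace_super_carrier[OF vs1.vector_space_axioms N(1)])
  have N_carrier: "x \<in> super_carrier N" if "x \<in> N i" for x i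
  proof (cases "i = 0")
    case True
    then have "x = x + 0" "x \<in> N 0" "0 \<in> N 1" using that W.subspace_0[OF N(1)] by simp_all
    then show ?thesis unfolding super_carrier_def by blast
  next
    case False
    then have "x = 0 + x" "0 \<in> N 0" "x \<in> N 1" using that W.subspace_0[OF N(1)] by (simp_all add: bit_not_zero_iff)
    then show ?thesis unfolding super_carrier_def by blast
  qed
  obtain g where g: "range g \<subseteq> super_carrier N" "Vector_Spaces.linear sU sW g"
    "\<forall>u\<in>\<kappa> ` super_carrier N. \<kappa> (g u) = u"
    using linear_exists_right_inverse_on[OF lin sub] by blast
  interpret g: module_hom sU sW g using g(2) by (simp add: module_hom_iff_linear)
  define lift :: "('v \<Rightarrow> 'w \<Rightarrow> 'w) \<Rightarrow> 'v \<Rightarrow> 'u \<Rightarrow> 'u" where "lift X a u = \<kappa> (X a (g u))" for X a u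
  have lift: "lift X a (\<kappa> x) = \<kappa> (X a x)"
    if X: "biadditive X" and kerX: "\<And>a i x. a \<in> V i \<Longrightarrow> x \<in> super_carrier N \<Longrightarrow> \<kappa> x = 0 \<Longrightarrow> \<kappa> (X a x) = 0"
      and x: "x \<in> N j" for X a x j
  proof -
    interpret X: biadditive X by (rule X)
    obtain a0 a1 where a: "a = a0 + a1" "a0 \<in> V 0" "a1 \<in> V 1" by (rule homogeneous_decomposition)
    have "g (\<kappa> x) - x \<in> super_carrier N"
      using g(1) N_carrier[OF x] W.subspace_diff[OF sub] by auto
    moreover have "\<kappa> (g (\<kappa> x) - x) = 0"
      using g(3) N_carrier[OF x] by (simp add: k.diff)
    ultimately have "\<kappa> (X a0 (g (\<kappa> x) - x)) = 0" "\<kappa> (X a1 (g (\<kappa> x) - x)) = 0"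
      using kerX a by blast+
    then show ?thesis
      by (simp add: lift_def a(1) X.add_l X.diff_r k.diff k.add algebra_simps)
  qed
  have liftA: "lift A a (\<kappa> x) = \<kappa> (A a x)" if "x \<in> N j" for a x j
    by (rule lift[OF A.biadditive_axioms _ that]) (use ker in blast)
  have liftB: "lift B a (\<kappa> x) = \<kappa> (B a x)" if "x \<in> N j" for a x j
    by (rule lift[OF B.biadditive_axioms _ that]) (use ker in blast)
  have liftC: "lift C a (\<kappa> x) = \<kappa> (C a x)" if "x \<in> N j" for a x j
    by (rule lift[OF C.biadditive_axioms _ that]) (use ker in blast)
  have lift_hom: "module_hom s sU (\<lambda>a. lift X a u)" "module_hom sU sU (lift X a)"
    if "\<And>x. module_hom s sW (\<lambda>a. X a x)" "\<And>a. module_hom sW sW (X a)" for X a u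
    unfolding lift_def[abs_def]
    using module_hom_compose[OF that(1) \<kappa>]
      module_hom_compose[OF module_hom_compose[OF g.module_hom_axioms that(2)] \<kappa>]
    by (simp_all add: comp_def)
  have "gd_action s V circ brk sU (\<lambda>i. \<kappa> ` N i) (lift A) (lift B) (lift C)"
  proof (intro gd_action.intro gd_action_axioms.intro)
    show "gd_superalgebra s V circ brk" by unfold_locales
    show "super_module sU (\<lambda>i. \<kappa> ` N i)"
    proof (intro super_module.intro super_module_axioms.intro)
      show "module sU" by (rule k.m2.module_axioms)
      show "k.m2.subspace (\<kappa> ` N i)" for i by (rule k.subspace_image[OF N(1)])
      have "\<kappa> x = 0" if "x \<in> N 0" "y \<in> N 1" "\<kappa> x = \<kappa> y" for x y
        using ker_graded[OF that(1) W.subspace_neg[OF N(1) that(2)]] that(3) by (simp add: k.diff)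
      moreover have "0 \<in> \<kappa> ` N i" for i
        using k.zero W.subspace_0[OF N(1)] by (metis imageI)
      ultimately show "\<kappa> ` N 0 \<inter> \<kappa> ` N 1 = {0}" by fast
    qed
  next
    fix a x
    show "module_hom s sU (\<lambda>a. lift A a x)" "module_hom sU sU (lift A a)"
      "module_hom s sU (\<lambda>a. lift B a x)" "module_hom sU sU (lift B a)"
      "module_hom s sU (\<lambda>a. lift C a x)" "module_hom sU sU (lift C a)"
      by (rule lift_hom linear_A linear_B linear_C)+
  next
    fix a u i j assume a: "a \<in> V i" and "u \<in> \<kappa> ` N j"
    then obtain x where x: "x \<in> N j" "u = \<kappa> x" by auto
    show "lift A a u \<in> \<kappa> ` N (i + j)" "lift B a u \<in> \<kappa> ` N (i + j)" "lift C a u \<in> \<kappa> ` N (i + j)"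
      unfolding x(2) liftA[OF x(1)] liftB[OF x(1)] liftC[OF x(1)]
      using closed[OF a x(1)] by blast+
  next
    fix a b u i j l assume a: "a \<in> V i" and b: "b \<in> V j" and "u \<in> \<kappa> ` N l"
    then obtain x where x: "x \<in> N l" "u = \<kappa> x" by auto
    then have xW: "x \<in> W l" using N(2) by auto
    have cl: "A a x \<in> N (i + l)" "B a x \<in> N (i + l)" "C a x \<in> N (i + l)"
      "A b x \<in> N (j + l)" "B b x \<in> N (j + l)" "C b x \<in> N (j + l)"
      using closed[OF a x(1)] closed[OF b x(1)] by blast+
    note L = x(2) liftA[OF x(1)] liftB[OF x(1)] liftC[OF x(1)]
      liftA[OF cl(1)] liftA[OF cl(2)] liftA[OF cl(3)] liftA[OF cl(4)] liftA[OF cl(5)] liftA[OF cl(6)]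
      liftB[OF cl(1)] liftB[OF cl(2)] liftB[OF cl(3)] liftB[OF cl(4)] liftB[OF cl(5)] liftB[OF cl(6)]
      liftC[OF cl(1)] liftC[OF cl(2)] liftC[OF cl(3)] liftC[OF cl(4)] liftC[OF cl(5)] liftC[OF cl(6)]
    have ks: "ksgn i j (\<kappa> y) = \<kappa> (ksgn i j y)" for y by (simp add: ksgn_def k.neg)
    note S = ks k.add[symmetric] k.diff[symmetric]
    show "lift A a (lift A b u) - ksgn i j (lift A b (lift A a u)) = lift A (brk a b) u"
      unfolding L S AA[OF a b xW] ..
    show "lift A a (lift B b u) - ksgn i j (lift B b (lift A a u)) +
        (lift B a (lift A b u) - ksgn i j (lift A b (lift B a u))) = lift B (brk a b) u"
      unfolding L S AB[OF a b xW] ..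
    show "lift B a (lift B b u) - ksgn i j (lift B b (lift B a u)) = 0"
      unfolding L S BB[OF a b xW] by (rule k.zero)
    show "lift A a (lift B b u) + (lift C a (lift A b u) - ksgn i j (lift A b (lift C a u))) =
        lift C (brk a b) u + lift A (circ a b) u"
      unfolding L S AC[OF a b xW] ..
    show "lift C a (lift B b u) = lift C (circ a b) u"
      unfolding L S CB[OF a b xW] ..
    show "lift C a (lift C b u) - ksgn i j (lift C b (lift C a u)) =
        lift C (circ a b) u - ksgn i j (lift C (circ b a) u)"
      unfolding L S CC[OF a b xW] ..
    show "lift B a (lift B b u) + (lift C a (lift B b u) - ksgn i j (lift B b (lift C a u))) =
        lift B (circ a b) u"
      unfolding L S BC[OF a b xW] ..
  qed
  then show thesis by (rule that) (rule liftC)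
qed

text \<open>
  A polynomial \<open>f = \<Sum>\<^sub>n \<partial>\<^sup>n a\<^sub>n\<close> sends \<open>w\<close> to \<open>\<Sum>\<^sub>n (-\<lambda>)\<^sup>n (A a\<^sub>n w + \<partial> B a\<^sub>n w + \<lambda> C a\<^sub>n w)\<close>, whose leading
  coefficient in \<open>\<lambda>\<close> is \<open>\<plusminus> C a\<^sub>n w\<close> for the largest \<open>n\<close>.
\<close>

lemma (in gd_action) faithful_repI:
  assumes w: "w \<in> W 0" and inj: "\<And>a. C a w = 0 \<Longrightarrow> a = 0"
  shows "faithful_rep (hgrade W) rep"
proof -
  interpret br: biadditive rep
    by (rule biadditive_sesqui_extension[OF biadditive_action_gen])
  \<comment> \<open>Values that are constant in \<open>\<lambda>\<close> have to be admitted for the induction: if the value of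
    \<open>a + \<partial> f\<close> is constant, then that of \<open>f\<close> is \<open>C a w\<close>.\<close>
  have zero: "f = 0" if "rep f [:w:] = [:c:]" for f c
    using that
  proof (induction f arbitrary: c)
    case (pCons a f)
    have "pCons a f = [:a:] + pCons 0 f" by simp
    then have "rep (pCons a f) [:w:] = action_gen A B C a w - pCons 0 (rep f [:w:])"
      using biadditive_action_gen by (simp only: br.add_l sesqui_extension_const sesqui_extension_del_left) simp
    then have e: "pCons ([:A a w, B a w:]) ([:[:C a w:]:] - rep f [:w:]) = [:c:]"
      using pCons.prems by (simp add: action_gen_def)
    then have r: "rep f [:w:] = [:[:C a w:]:]" by simp
    then have "f = 0" by (rule pCons.IH)
    then have "C a w = 0" using r by (simp add: br.zero_l)
    then show ?case using \<open>f = 0\<close> inj by simp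
  qed simp
  have "[:w:] \<in> super_carrier (hgrade W)"
  proof -
    have "[:w:] \<in> hgrade W 0" "0 \<in> hgrade W 1"
      using w W.subspace_0[OF W.subspace_G] by (auto simp: hgrade_def coeff_pCons split: nat.split)
    moreover have "[:w:] = [:w:] + 0" by simp
    ultimately show ?thesis unfolding super_carrier_def by blast
  qed
  then show ?thesis unfolding faithful_rep_def using zero[of _ 0] by auto
qed

theorem theorem3:
  fixes s :: "'k::field_char_0 \<Rightarrow> 'v::ab_group_add \<Rightarrow> 'v"
    and V :: "bit \<Rightarrow> 'v set"
    and circ brk :: "'v \<Rightarrow> 'v \<Rightarrow> 'v"
  assumes "special_gd_superalgebra TYPE('p::ab_group_add) s V circ brk"
    and "finite_dim s (UNIV :: 'v set)"
  shows "\<exists>(U :: bit \<Rightarrow> (nat \<Rightarrow> 'k) set) \<rho>.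
    finite_conformal_representation
      (hscale s) (hgrade V) (quad_bracket V circ brk) seq_scale U \<rho> \<and>
    faithful_rep (hgrade U) \<rho>"
proof -
  from assms(1) obtain sP :: "'k \<Rightarrow> 'p \<Rightarrow> 'p" and P mul pb d \<phi> where
    gd: "gd_superalgebra s V circ brk" and
    P: "poisson_superalgebra_derivation sP P mul pb d" and
    \<phi>: "module_hom s sP \<phi>" "inj \<phi>" "\<And>i. \<phi> ` V i \<subseteq> P i"
      "\<And>a b. \<phi> (circ a b) = mul (\<phi> a) (d (\<phi> b))" "\<And>a b. \<phi> (brk a b) = pb (\<phi> a) (\<phi> b)"
    unfolding special_gd_superalgebra_def deriv_circ_def by blast
  have poisson: "poisson_superalgebra sP P mul pb"
    by (rule poisson_superalgebra_derivation.axioms(1)[OF P])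
  have pm: "superalgebra sP P mul" by (rule poisson_superalgebra.axioms(1)[OF poisson])
  have pb: "superalgebra sP P pb"
    by (rule lie_superalgebra.axioms(1)[OF poisson_superalgebra.axioms(2)[OF poisson]])
  interpret gd_embedding s V circ brk sP P mul pb d \<phi>
    by (intro gd_embedding.intro gd_embedding_axioms.intro gd pm pb P \<phi>) (use \<phi>(3) in auto)
  interpret E: gd_action s V circ brk ext_scale ext_grade A B C
    by (rule hamiltonian_action)
  have vs: "vector_space s" "vector_space sP" "vector_space ext_scale"
    using V.module_axioms pm.module_axioms E.W.module_axioms by (simp_all add: module_iff_vector_space)
  have "Vector_Spaces.linear s sP \<phi>" using \<phi>(1) by (simp add: module_hom_iff_linear)
  then obtain \<psi> where \<psi>: "Vector_Spaces.linear sP s \<psi>" "\<psi> \<circ> \<phi> = id"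
    using vector_space_pair.linear_injective_left_inverse[OF _ _ \<phi>(2)] vs
    by (auto simp: vector_space_pair_def)
  have \<psi>\<phi>: "\<psi> (\<phi> v) = v" for v using \<psi>(2) by (simp add: fun_eq_iff)
  have \<psi>_hom: "module_hom sP s \<psi>" using \<psi>(1) by (simp add: module_hom_iff_linear)
  have \<psi>_0: "\<psi> y = 0 \<longleftrightarrow> y = 0" if "y \<in> range \<phi>" for y
    using that \<psi>\<phi> phi_simps(4) module_hom.zero[OF \<psi>_hom] by auto
  obtain B0 where B0: "finite B0" "module.span s B0 = UNIV"
    using assms(2) unfolding finite_dim_def by auto
  \<comment> \<open>The common kernel of these maps on the multipliers is the subrepresentation to be factored out;
    a spanning set suffices because \<open>mult w\<close> is linear.\<close>
  define Q where "Q = insert (\<lambda>w. \<psi> (snd (snd w))) ((\<lambda>b w. \<psi> (mult w b)) ` B0)"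
  have x_hom: "module_hom ext_scale sP (\<lambda>w. snd (snd w))"
    unfolding module_hom_def module_hom_axioms_def
    using E.W.module_axioms pm.module_axioms by (simp add: ext_scale_def split_beta)
  have Q: "module_hom ext_scale s q" if "q \<in> Q" for q
    using that B0 module_hom_compose[OF mult_linear \<psi>_hom] module_hom_compose[OF x_hom \<psi>_hom]
    by (auto simp: Q_def comp_def)
  have "finite Q" using B0 by (simp add: Q_def)
  from sequence_coordinates[OF vs(1,3) assms(2) this Q]
  obtain \<kappa> F where \<kappa>: "module_hom ext_scale seq_scale \<kappa>" "\<And>w. \<kappa> w = 0 \<longleftrightarrow> (\<forall>q\<in>Q. q w = 0)"
    and F: "finite F" "range \<kappa> \<subseteq> module.span seq_scale F" by blast
  have \<kappa>_0: "\<kappa> w = 0 \<longleftrightarrow> annihilates w" if w: "\<And>v. mult w v \<in> range \<phi>" "snd (snd w) \<in> range \<phi>" for w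
  proof -
    have mult_hom: "module_hom s sP (mult w)"
      unfolding module_hom_def module_hom_axioms_def
      using V.module_axioms pm.module_axioms additive.add[OF additive_mult]
      by (simp add: mult_def split_beta phi_simps pm.mul_scale pm.scale_right_distrib mult.commute)
    have "(\<forall>b\<in>B0. \<psi> (mult w b) = 0) \<longleftrightarrow> (\<forall>v. mult w v = 0)"
      using module_hom.eq_0_on_span[OF mult_hom, of B0] B0(2) \<psi>_0[OF w(1)] by auto
    then show ?thesis
      unfolding \<kappa>(2) Q_def annihilates_def using \<psi>_0[OF w(2)] by auto
  qed
  have carrier: "mult w v \<in> range \<phi>" "snd (snd w) \<in> range \<phi>" if "w \<in> super_carrier multipliers" for w v
  proof -
    obtain w0 w1 where "w = w0 + w1" "w0 \<in> multipliers 0" "w1 \<in> multipliers 1"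
      using \<open>w \<in> super_carrier multipliers\<close> unfolding super_carrier_def by blast
    then show "mult w v \<in> range \<phi>" "snd (snd w) \<in> range \<phi>"
      by (auto simp: multipliers_def module_hom.add[OF mult_linear] intro!: pm.subspace_add[OF subspace_range])
  qed
  have N_range: "mult w v \<in> range \<phi>" "snd (snd w) \<in> range \<phi>" if "w \<in> multipliers i" for w v i
    using that by (simp_all add: multipliers_def)
  have closed: "A a x \<in> multipliers (i + j) \<and> B a x \<in> multipliers (i + j) \<and> C a x \<in> multipliers (i + j)"
    if "a \<in> V i" "x \<in> multipliers j" for a x i j
    using multipliers_closed[OF that] by blast
  have ker: "\<kappa> (A a x) = 0 \<and> \<kappa> (B a x) = 0 \<and> \<kappa> (C a x) = 0"
    if a: "a \<in> V i" and x: "x \<in> super_carrier multipliers" "\<kappa> x = 0" for a x i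
  proof -
    have "annihilates x" using \<kappa>_0[OF carrier[OF x(1)]] x(2) by simp
    note z = annihilates_closed[OF a this]
    have "\<kappa> w = 0" if "annihilates w" for w
      using that \<psi>_0 pm.subspace_0[OF subspace_range] by (auto simp: \<kappa>(2) Q_def annihilates_def)
    then show ?thesis using z by blast
  qed
  have ker_graded: "\<kappa> x = 0" if "x \<in> multipliers 0" "y \<in> multipliers 1" "\<kappa> (x + y) = 0" for x y
  proof -
    have "x + y \<in> super_carrier multipliers" using that unfolding super_carrier_def by blast
    then have "annihilates (x + y)" using \<kappa>_0[OF carrier] that(3) by blast
    then have "annihilates x"
      using annihilates_homogeneous that(1,2) unfolding multipliers_def by blast
    then show ?thesis using \<kappa>_0[OF N_range[OF that(1)]] by simp
  qed
  obtain A' B' C' where U: "gd_action s V circ brk seq_scale (\<lambda>i. \<kappa> ` multipliers i) A' B' C'"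
    and C': "\<And>a j x. x \<in> multipliers j \<Longrightarrow> C' a (\<kappa> x) = \<kappa> (C a x)"
    by (rule E.subquotient[where N = multipliers, OF subspace_multipliers _ closed \<kappa>(1) ker ker_graded])
      (auto simp: multipliers_def)
  interpret U: gd_action s V circ brk seq_scale "\<lambda>i. \<kappa> ` multipliers i" A' B' C' by (rule U)
  have "module.subspace seq_scale (super_carrier (\<lambda>i. \<kappa> ` multipliers i))"
    by (rule subspace_super_carrier[OF vector_space_seq_scale U.W.subspace_G])
  moreover have "super_carrier (\<lambda>i. \<kappa> ` multipliers i) \<subseteq> module.span seq_scale F"
    using F(2) U.W.span_add unfolding super_carrier_def by blast
  ultimately have "finite_dim seq_scale (super_carrier (\<lambda>i. \<kappa> ` multipliers i))"
    by (rule finite_dim_subspace[OF vector_space_seq_scale F(1)])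
  moreover have "faithful_rep (hgrade (\<lambda>i. \<kappa> ` multipliers i)) U.rep"
  proof (rule U.faithful_repI)
    have one: "(1, 0, 0) \<in> multipliers 0"
      by (simp add: multipliers_def ext_grade_def mult_def pm.subspace_0[OF pm.subspace_G]
          pm.subspace_0[OF subspace_range] pm.mul.zero_r)
    then show "\<kappa> (1, 0, 0) \<in> \<kappa> ` multipliers 0" by (rule imageI)
    show "a = 0" if "C' a (\<kappa> (1, 0, 0)) = 0" for a
    proof -
      have "\<kappa> (0, d (\<phi> a), \<phi> a) = 0"
        using that C'[OF one] by (simp add: C_def d_simps pm.mul.zero_r)
      then have "\<psi> (\<phi> a) = 0" by (simp add: \<kappa>(2) Q_def)
      then show ?thesis by (simp add: \<psi>\<phi>)
    qed
  qed
  ultimately show ?thesis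
    using U.conformal_representation_rep U.W.super_module_axioms
    unfolding finite_conformal_representation_def by blast
qed

end
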